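(* Let $(M,g)$ be a Riemannian manifold of dimension $4$. The following assertions are equivalent: (i) $(M,g)$ is pointwise Osserman. (ii) $(M,g)$ satisfies the Rakić duality principle.
   Context: Let $R$ be the curvature tensor of $(M,g)$. For $p\in M$ and $x\in T_pM$, the Jacobi operator is $\mathcal{J}(x)=R(\cdot,x)x$, i.e. $\mathcal{J}(x)y=R(y,x)x$ for $y\in T_pM$; the sign convention for $R$ is the one for which $g(R(y,x)x,y)$ is the sectional curvature of the plane spanned by orthonormal $x,y$. It is a self-adjoint operator with $\mathcal{J}(x)x=0$. Pointwise Osserman: $(M,g)$ is pointwise Osserman if, for every point $p\in M$, the eigenvalues (counted with multiplicity) of $\mathcal{J}(x)$ do not depend on the unit vector $x\in T_pM$ (the eigenvalues may vary with $p$). Rakić duality principle: $(M,g)$ satisfies the Rakić duality principle if for every point $p\in M$, any unit vectors $x,y\in T_pM$ and any real number $\lambda$, $\mathcal{J}(x)y=\lambda y$ implies $\mathcal{J}(y)x=\lambda x$. *)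

theory Defs
  imports "HOL-Analysis.Analysis" "HOL-Library.Function_Algebras"
begin

section \<open>Pointwise vector space structure on functions\<close>

text \<open>Tangent vectors are represented below as families of component vectors, i.e. as functions.
  Addition, zero and subtraction of functions come from the library; with this instance \<open>dim\<close> and
  \<open>*\<^sub>R\<close> can be used for them.\<close>

instantiation "fun" :: (type, real_vector) real_vector
begin

definition scaleR_fun :: "real \<Rightarrow> ('a \<Rightarrow> 'b) \<Rightarrow> 'a \<Rightarrow> 'b"
  where "scaleR_fun a f = (\<lambda>x. a *\<^sub>R f x)"

instance
  by standard (simp_all add: scaleR_fun_def fun_eq_iff scaleR_add_left scaleR_add_right)

end

section \<open>Smooth functions on open subsets of Euclidean space\<close>

definition partial :: "'n::finite \<Rightarrow> (real^'n \<Rightarrow> 'b::real_normed_vector) \<Rightarrow> real^'n \<Rightarrow> 'b"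
  where "partial i f u = frechet_derivative f (at u) (axis i 1)"

text \<open>The following two predicates are meant for open \<open>S\<close>.\<close>

primrec C_k_on :: "nat \<Rightarrow> (real^'n::finite) set \<Rightarrow> (real^'n \<Rightarrow> 'b::real_normed_vector) \<Rightarrow> bool"
  where
    "C_k_on 0 S f \<longleftrightarrow> continuous_on S f"
  | "C_k_on (Suc k) S f \<longleftrightarrow> f differentiable_on S \<and> (\<forall>i. C_k_on k S (partial i f))"

definition smooth_on :: "(real^'n::finite) set \<Rightarrow> (real^'n \<Rightarrow> 'b::real_normed_vector) \<Rightarrow> bool"
  where "smooth_on S f \<longleftrightarrow> (\<forall>k. C_k_on k S f)"

section \<open>Smooth manifolds\<close>

text \<open>A chart is a pair of its domain and its coordinate map; the values of the coordinate map
  outside the domain are irrelevant.\<close>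

type_synonym ('m, 'n) chart = "'m set \<times> ('m \<Rightarrow> real^'n)"

definition chart_inv :: "('m, 'n::finite) chart \<Rightarrow> real^'n \<Rightarrow> 'm"
  where "chart_inv c = inv_into (fst c) (snd c)"

definition transition :: "('m, 'n::finite) chart \<Rightarrow> ('m, 'n) chart \<Rightarrow> real^'n \<Rightarrow> real^'n"
  where "transition c d = snd d \<circ> chart_inv c"

definition charts_at :: "('m, 'n::finite) chart set \<Rightarrow> 'm \<Rightarrow> ('m, 'n) chart set"
  where "charts_at A p = {c \<in> A. p \<in> fst c}"

locale smooth_manifold =
  fixes X :: "'m topology" and A :: "('m, 'n::finite) chart set"
  assumes Hausdorff: "Hausdorff_space X"
    and second_countable:
      "\<exists>\<B>. countable \<B> \<and> (\<forall>V\<in>\<B>. openin X V) \<and>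
         (\<forall>W p. openin X W \<and> p \<in> W \<longrightarrow> (\<exists>V\<in>\<B>. p \<in> V \<and> V \<subseteq> W))"
    and chart_domain: "c \<in> A \<Longrightarrow> openin X (fst c)"
    and chart_image: "c \<in> A \<Longrightarrow> open (snd c ` fst c)"
    and chart_homeomorphism:
      "c \<in> A \<Longrightarrow> homeomorphic_map (subtopology X (fst c)) (top_of_set (snd c ` fst c)) (snd c)"
    and charts_cover: "(\<Union>c\<in>A. fst c) = topspace X"
    and charts_compatible:
      "c \<in> A \<Longrightarrow> d \<in> A \<Longrightarrow> smooth_on (snd c ` (fst c \<inter> fst d)) (transition c d)"

section \<open>Tangent spaces\<close>

text \<open>A tangent vector at \<open>p\<close> is a family of component vectors, one for every chart around \<open>p\<close>,
  related by the differentials of the transition maps. Components with respect to the other charts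
  are set to \<open>0\<close>, so that the tangent space is a linear subspace of the space of all families.\<close>

type_synonym ('m, 'n) tangent = "('m, 'n) chart \<Rightarrow> real^'n"

definition tangent_space :: "('m, 'n::finite) chart set \<Rightarrow> 'm \<Rightarrow> ('m, 'n) tangent set"
  where "tangent_space A p =
    {v. (\<forall>c \<in> charts_at A p. \<forall>d \<in> charts_at A p.
           v d = frechet_derivative (transition c d) (at (snd c p)) (v c)) \<and>
        (\<forall>c. c \<notin> charts_at A p \<longrightarrow> v c = 0)}"

text \<open>The tangent vector at \<open>p\<close> with components \<open>a\<close> in the chart \<open>c\<close>.\<close>

definition tangent_of ::
    "('m, 'n::finite) chart set \<Rightarrow> 'm \<Rightarrow> ('m, 'n) chart \<Rightarrow> real^'n \<Rightarrow> ('m, 'n) tangent"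
  where "tangent_of A p c a =
    (\<lambda>d. if d \<in> charts_at A p then frechet_derivative (transition c d) (at (snd c p)) a else 0)"

section \<open>Riemannian metrics\<close>

type_synonym ('m, 'n) metric = "'m \<Rightarrow> ('m, 'n) tangent \<Rightarrow> ('m, 'n) tangent \<Rightarrow> real"

text \<open>The Gram matrix \<open>g\<^sub>i\<^sub>j = g(\<partial>\<^sub>i, \<partial>\<^sub>j)\<close> in the chart \<open>c\<close>, as a function of the coordinates.\<close>

definition gram ::
    "('m, 'n::finite) chart set \<Rightarrow> ('m, 'n) metric \<Rightarrow> ('m, 'n) chart \<Rightarrow> real^'n \<Rightarrow> real^'n^'n"
  where "gram A g c u = (let p = chart_inv c u in
    \<chi> i j. g p (tangent_of A p c (axis i 1)) (tangent_of A p c (axis j 1)))"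

locale riemannian_manifold = smooth_manifold X A
  for X :: "'m topology" and A :: "('m, 'n::finite) chart set" +
  fixes g :: "('m, 'n) metric"
  assumes metric_add:
      "p \<in> topspace X \<Longrightarrow> u \<in> tangent_space A p \<Longrightarrow> v \<in> tangent_space A p \<Longrightarrow>
       w \<in> tangent_space A p \<Longrightarrow> g p (u + v) w = g p u w + g p v w"
    and metric_scaleR:
      "p \<in> topspace X \<Longrightarrow> u \<in> tangent_space A p \<Longrightarrow> v \<in> tangent_space A p \<Longrightarrow>
       g p (a *\<^sub>R u) v = a * g p u v"
    and metric_sym:
      "p \<in> topspace X \<Longrightarrow> u \<in> tangent_space A p \<Longrightarrow> v \<in> tangent_space A p \<Longrightarrow> g p u v = g p v u"
    and metric_pos:
      "p \<in> topspace X \<Longrightarrow> u \<in> tangent_space A p \<Longrightarrow> u \<noteq> 0 \<Longrightarrow> 0 < g p u u"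
    and metric_smooth:
      "c \<in> A \<Longrightarrow> smooth_on (snd c ` fst c) (\<lambda>u. gram A g c u $ i $ j)"

section \<open>Curvature\<close>

text \<open>\<open>\<Gamma>\<^sup>l\<^sub>i\<^sub>j\<close>, the Christoffel symbols of the Levi-Civita connection:
  \<open>\<nabla>\<^bsub>\<partial>\<^sub>i\<^esub> \<partial>\<^sub>j = \<Sum>l. \<Gamma>\<^sup>l\<^sub>i\<^sub>j \<partial>\<^sub>l\<close>.\<close>

definition christoffel ::
    "('m, 'n::finite) chart set \<Rightarrow> ('m, 'n) metric \<Rightarrow> ('m, 'n) chart \<Rightarrow> 'n \<Rightarrow> 'n \<Rightarrow> 'n \<Rightarrow> real^'n \<Rightarrow> real"
  where "christoffel A g c l i j u =
    (\<Sum>m\<in>UNIV. matrix_inv (gram A g c u) $ l $ m *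
       (partial i (\<lambda>u. gram A g c u $ j $ m) u + partial j (\<lambda>u. gram A g c u $ i $ m) u
        - partial m (\<lambda>u. gram A g c u $ i $ j) u)) / 2"

text \<open>The \<open>l\<close>-th component of \<open>R(\<partial>\<^sub>i, \<partial>\<^sub>j)\<partial>\<^sub>k\<close>, where
  \<open>R(Y, Z)W = \<nabla>\<^sub>Y \<nabla>\<^sub>Z W - \<nabla>\<^sub>Z \<nabla>\<^sub>Y W - \<nabla>\<^bsub>[Y, Z]\<^esub> W\<close>. With this sign, \<open>g(R(y, x)x, y)\<close> is the sectional
  curvature of the plane spanned by orthonormal \<open>x\<close>, \<open>y\<close>.\<close>

definition riemann_coeff ::
    "('m, 'n::finite) chart set \<Rightarrow> ('m, 'n) metric \<Rightarrow> ('m, 'n) chart \<Rightarrow>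
     'n \<Rightarrow> 'n \<Rightarrow> 'n \<Rightarrow> 'n \<Rightarrow> real^'n \<Rightarrow> real"
  where "riemann_coeff A g c l i j k u =
    partial i (christoffel A g c l j k) u - partial j (christoffel A g c l i k) u
    + (\<Sum>m\<in>UNIV. christoffel A g c l i m u * christoffel A g c m j k u
               - christoffel A g c l j m u * christoffel A g c m i k u)"

text \<open>The curvature tensor \<open>R(x, y)z\<close> at \<open>p\<close>, computed in a chart around \<open>p\<close>. Since the
  coefficients above transform as a tensor, the choice of the chart is immaterial.\<close>

definition curvature ::
    "('m, 'n::finite) chart set \<Rightarrow> ('m, 'n) metric \<Rightarrow> 'm \<Rightarrow>
     ('m, 'n) tangent \<Rightarrow> ('m, 'n) tangent \<Rightarrow> ('m, 'n) tangent \<Rightarrow> ('m, 'n) tangent"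
  where "curvature A g p x y z = (let c = (SOME c. c \<in> charts_at A p) in
    tangent_of A p c (\<chi> l. \<Sum>i\<in>UNIV. \<Sum>j\<in>UNIV. \<Sum>k\<in>UNIV.
      riemann_coeff A g c l i j k (snd c p) * x c $ i * y c $ j * z c $ k))"

section \<open>Jacobi operators\<close>

definition jacobi ::
    "('m, 'n::finite) chart set \<Rightarrow> ('m, 'n) metric \<Rightarrow> 'm \<Rightarrow>
     ('m, 'n) tangent \<Rightarrow> ('m, 'n) tangent \<Rightarrow> ('m, 'n) tangent"
  where "jacobi A g p x y = curvature A g p y x x"

definition unit_tangent_vectors ::
    "('m, 'n::finite) chart set \<Rightarrow> ('m, 'n) metric \<Rightarrow> 'm \<Rightarrow> ('m, 'n) tangent set"
  where "unit_tangent_vectors A g p = {x \<in> tangent_space A p. g p x x = 1}"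

text \<open>Jacobi operators are self-adjoint, so the multiplicity of an eigenvalue is the dimension of
  its eigenspace. It is \<open>0\<close> if \<open>\<mu>\<close> is not an eigenvalue.\<close>

definition jacobi_multiplicity ::
    "('m, 'n::finite) chart set \<Rightarrow> ('m, 'n) metric \<Rightarrow> 'm \<Rightarrow> ('m, 'n) tangent \<Rightarrow> real \<Rightarrow> nat"
  where "jacobi_multiplicity A g p x \<mu> = dim {y \<in> tangent_space A p. jacobi A g p x y = \<mu> *\<^sub>R y}"

definition pointwise_osserman ::
    "'m topology \<Rightarrow> ('m, 'n::finite) chart set \<Rightarrow> ('m, 'n) metric \<Rightarrow> bool"
  where "pointwise_osserman X A g \<longleftrightarrow>
    (\<forall>p \<in> topspace X. \<forall>x \<in> unit_tangent_vectors A g p. \<forall>x' \<in> unit_tangent_vectors A g p.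
       \<forall>\<mu>. jacobi_multiplicity A g p x \<mu> = jacobi_multiplicity A g p x' \<mu>)"

definition rakic_duality ::
    "'m topology \<Rightarrow> ('m, 'n::finite) chart set \<Rightarrow> ('m, 'n) metric \<Rightarrow> bool"
  where "rakic_duality X A g \<longleftrightarrow>
    (\<forall>p \<in> topspace X. \<forall>x \<in> unit_tangent_vectors A g p. \<forall>y \<in> unit_tangent_vectors A g p.
       \<forall>\<mu>. jacobi A g p x y = \<mu> *\<^sub>R y \<longrightarrow> jacobi A g p y x = \<mu> *\<^sub>R x)"

end

theory Submission
  imports Defs
begin

text \<open>
Both conditions concern one tangent space at a time, and there they are statements about a curvature
tensor \<open>R\<close> on a Euclidean space with Jacobi operators \<open>J\<^sub>x y = R(y, x)x\<close>. The link between them is an identity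
that follows from the symmetries of \<open>R\<close> (\<open>jac_polar_inner\<close>): if \<open>B\<close> denotes the derivative of \<open>J\<close> at \<open>x\<close>
in a direction \<open>z\<close> orthogonal to \<open>x\<close>, then \<open>B y \<bullet> y = 2 (J\<^sub>y x \<bullet> z)\<close>. For a unit eigenvector \<open>y\<close> of \<open>J\<^sub>x\<close> the
left-hand side is the first-order change of the eigenvalue, and the right-hand side vanishes for all such \<open>z\<close> if and
only if \<open>J\<^sub>y x\<close> is a multiple of \<open>x\<close>. The factor of this multiple is then the eigenvalue of \<open>y\<close>, because
\<open>J\<^sub>y x \<bullet> x = J\<^sub>x y \<bullet> y\<close>. So duality says that eigenvalues of Jacobi operators are stationary, and the Osserman
condition says that they are constant.

To make this precise without differentiating eigenvalues or eigenvectors, polynomials of \<open>J\<^sub>x\<close> with real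
roots are used. Suppose that duality holds. At every point of a great circle, the derivative of the trace
of \<open>\<Prod>(J\<^sub>x - a)\<close> can be evaluated in a fixed eigenbasis of \<open>J\<^sub>x\<close> and vanishes
(\<open>trace_constant_on_arc\<close>); these traces are therefore the same for all unit vectors, and they determine the
multiplicities (\<open>same_traces_imp_same_multiplicities\<close>). Conversely, under the Osserman condition one
polynomial with simple roots annihilates all \<open>J\<^sub>x\<close>, and differentiating this relation, paired with an
eigenvector \<open>y\<close>, yields \<open>B y \<bullet> y = 0\<close> (\<open>osserman_imp_duality\<close>).

The geometric input is that the curvature of a Riemannian metric, defined by Christoffel symbols in a chart,
satisfies \<open>g(R(x, y)z, w) = g(R(z, w)x, y)\<close> (\<open>curvature_in_chart_pair_symmetric\<close>). This comes from the formula
\<open>lowered_curvature_eq\<close> for the tensor with lowered indices and from the symmetry of second partial derivatives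
(\<open>partial_commute\<close>). Finally, each tangent space is identified isometrically with a standard Euclidean
space (\<open>curvature_pointwise_normal_form\<close>).
\<close>

section \<open>Orthonormal eigenbases of self-adjoint operators\<close>

definition orthonormal_basis :: "'a::euclidean_space set \<Rightarrow> bool"
  where "orthonormal_basis B \<longleftrightarrow> pairwise orthogonal B \<and> (\<forall>b\<in>B. norm b = 1) \<and> span B = UNIV"

text \<open>A unit vector of \<open>S\<close> at which the quadratic form \<open>f v \<bullet> v\<close> is largest is an eigenvector: the residual
\<open>w = f v - \<mu> v\<close> would otherwise be a direction in which the form increases to first order.\<close>

lemma selfadjoint_eigenvector_exists:
  fixes f :: "'a::euclidean_space \<Rightarrow> 'a"
  assumes "linear f" and self_adjoint: "\<And>x y. f x \<bullet> y = x \<bullet> f y"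
    and "subspace S" "S \<noteq> {0}" "f ` S \<subseteq> S"
  obtains v \<mu> where "v \<in> S" "norm v = 1" "f v = \<mu> *\<^sub>R v"
proof -
  interpret f: linear f by fact
  have "0 \<in> S" using \<open>subspace S\<close> by (rule subspace_0)
  with \<open>S \<noteq> {0}\<close> obtain u where u: "u \<in> S" "u \<noteq> 0" by blast
  have "compact (S \<inter> sphere 0 1)"
    using closed_subspace[OF \<open>subspace S\<close>] by (simp add: closed_Int_compact)
  moreover have "u /\<^sub>R norm u \<in> S \<inter> sphere 0 1"
    using u \<open>subspace S\<close> by (simp add: subspace_scale)
  moreover have "continuous_on (S \<inter> sphere 0 1) (\<lambda>v. f v \<bullet> v)"
    by (intro continuous_intros linear_continuous_on linear_linear[THEN iffD2] \<open>linear f\<close>)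
  ultimately obtain v where v: "v \<in> S" "norm v = 1"
    and max: "\<And>w. w \<in> S \<Longrightarrow> norm w = 1 \<Longrightarrow> f w \<bullet> w \<le> f v \<bullet> v"
    using continuous_attains_sup[of "S \<inter> sphere 0 1" "\<lambda>v. f v \<bullet> v"] by fastforce
  define \<mu> where "\<mu> = f v \<bullet> v"
  have rayleigh: "f w \<bullet> w \<le> \<mu> * (w \<bullet> w)" if "w \<in> S" for w
  proof (cases "w = 0")
    case False
    have "f (w /\<^sub>R norm w) \<bullet> (w /\<^sub>R norm w) \<le> \<mu>"
      unfolding \<mu>_def using that False \<open>subspace S\<close> by (intro max) (auto simp: subspace_scale)
    then have "f w \<bullet> w / (norm w)\<^sup>2 \<le> \<mu>"
      by (simp add: f.scaleR power2_eq_square divide_simps)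
    then show ?thesis
      using False by (simp add: divide_simps power2_norm_eq_inner)
  qed (simp add: f.zero)
  define w where "w = f v - \<mu> *\<^sub>R v"
  define c where "c = \<mu> * (w \<bullet> w) - f w \<bullet> w"
  have "w \<in> S"
    unfolding w_def using v(1) assms(3,5) by (intro subspace_diff subspace_scale) auto
  have key: "2 * t * (w \<bullet> w) \<le> t\<^sup>2 * c" for t
  proof -
    have "f (v + t *\<^sub>R w) \<bullet> (v + t *\<^sub>R w) \<le> \<mu> * ((v + t *\<^sub>R w) \<bullet> (v + t *\<^sub>R w))"
      using v(1) \<open>w \<in> S\<close> \<open>subspace S\<close> by (intro rayleigh subspace_add subspace_scale)
    moreover have vv: "v \<bullet> v = 1" using v(2) by (simp add: dot_square_norm)
    moreover have vw: "v \<bullet> w = 0"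
      by (simp add: w_def inner_diff_right vv \<mu>_def inner_commute)
    moreover have fvw: "f v \<bullet> w = w \<bullet> w"
      using vw by (subst (2) w_def) (simp add: inner_diff_left)
    moreover have "f w \<bullet> v = w \<bullet> w" using fvw by (metis self_adjoint inner_commute)
    ultimately show ?thesis
      by (simp add: f.add f.scaleR c_def inner_add_left inner_add_right algebra_simps
          power2_eq_square inner_commute[of w v] flip: \<mu>_def)
  qed
  \<comment> \<open>\<open>key\<close> compares a linear with a quadratic function of \<open>t\<close>; a small \<open>t > 0\<close> rules out \<open>w \<noteq> 0\<close>.\<close>
  have "w \<bullet> w \<le> 0"
  proof (rule ccontr)
    assume "\<not> w \<bullet> w \<le> 0"
    then have pos: "0 < w \<bullet> w" by linarith
    define t where "t = w \<bullet> w / (\<bar>c\<bar> + 1)"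
    have "0 < t" using pos by (simp add: t_def)
    with key[of t] have "2 * (w \<bullet> w) \<le> t * c" by (simp add: power2_eq_square)
    also have "\<dots> \<le> t * (\<bar>c\<bar> + 1)" using \<open>0 < t\<close> by (intro mult_left_mono) auto
    also have "\<dots> = w \<bullet> w" by (simp add: t_def)
    finally show False using pos by simp
  qed
  then have "w = 0" by (metis inner_eq_zero_iff inner_ge_zero order_antisym)
  then show ?thesis using that v by (simp add: w_def)
qed

text \<open>Induction on the dimension: the orthogonal complement in \<open>S\<close> of an eigenvector is again invariant,
by self-adjointness.\<close>

lemma selfadjoint_eigenbasis_of_invariant_subspace:
  fixes f :: "'a::euclidean_space \<Rightarrow> 'a"
  assumes "linear f" and self_adjoint: "\<And>x y. f x \<bullet> y = x \<bullet> f y"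
    and "subspace S" "f ` S \<subseteq> S"
  shows "\<exists>B. pairwise orthogonal B \<and> (\<forall>b\<in>B. norm b = 1 \<and> (\<exists>\<mu>. f b = \<mu> *\<^sub>R b)) \<and> span B = S"
  using assms(3,4)
proof (induction "dim S" arbitrary: S rule: less_induct)
  case less
  interpret f: linear f by fact
  show ?case
  proof (cases "S = {0}")
    case True
    then show ?thesis by (intro exI[of _ "{}"]) auto
  next
    case False
    obtain v \<mu> where v: "v \<in> S" "norm v = 1" "f v = \<mu> *\<^sub>R v"
      using selfadjoint_eigenvector_exists[OF assms(1,2) less.prems(1) False less.prems(2)] .
    have vv: "v \<bullet> v = 1" using v(2) by (simp add: dot_square_norm)
    define T where "T = {w \<in> S. v \<bullet> w = 0}"
    have T: "subspace T"
      using less.prems(1) by (auto simp: T_def subspace_def inner_add_right)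
    have "f ` T \<subseteq> T"
      using less.prems(2) by (auto simp: T_def v(3) simp flip: self_adjoint)
    have "v \<notin> T" using vv by (simp add: T_def)
    then have "T \<subset> S" using v(1) unfolding T_def by blast
    then have "dim T < dim S"
      using T less.prems(1) by (intro dim_psubset) (simp add: span_eq_iff[THEN iffD2])
    from less.hyps[OF this T \<open>f ` T \<subseteq> T\<close>] obtain B where
      B: "pairwise orthogonal B" "\<forall>b\<in>B. norm b = 1 \<and> (\<exists>\<mu>. f b = \<mu> *\<^sub>R b)" "span B = T" by blast
    have "B \<subseteq> T" using B(3) span_superset by blast
    have "span (insert v B) = S"
    proof
      show "span (insert v B) \<subseteq> S"
        using \<open>B \<subseteq> T\<close> v(1) less.prems(1) by (intro span_minimal) (auto simp: T_def)
      show "S \<subseteq> span (insert v B)"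
      proof
        fix w assume "w \<in> S"
        then have "w - (v \<bullet> w) *\<^sub>R v \<in> T"
          using v(1) less.prems(1) vv
          by (auto simp: T_def inner_diff_right intro!: subspace_diff subspace_scale)
        then show "w \<in> span (insert v B)"
          using B(3) by (auto simp: span_insert)
      qed
    qed
    moreover have "pairwise orthogonal (insert v B)"
      using B(1) \<open>B \<subseteq> T\<close> by (auto simp: pairwise_insert T_def orthogonal_def inner_commute)
    ultimately show ?thesis
      using B(2) v by (intro exI[of _ "insert v B"]) auto
  qed
qed

theorem selfadjoint_eigenbasis:
  fixes f :: "'a::euclidean_space \<Rightarrow> 'a"
  assumes "linear f" and "\<And>x y. f x \<bullet> y = x \<bullet> f y"
  obtains B ev where "orthonormal_basis B" "\<And>b. b \<in> B \<Longrightarrow> f b = ev b *\<^sub>R b"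
  using selfadjoint_eigenbasis_of_invariant_subspace[OF assms subspace_UNIV]
  by (auto simp: orthonormal_basis_def) metis

definition trace_of :: "('a::euclidean_space \<Rightarrow> 'a) \<Rightarrow> real"
  where "trace_of f = (\<Sum>i\<in>Basis. f i \<bullet> i)"

context
  fixes B :: "'a::euclidean_space set"
  assumes B: "orthonormal_basis B"
begin

lemma finite_orthonormal_basis: "finite B" and independent_orthonormal_basis: "independent B"
proof -
  have "0 \<notin> B" using B by (auto simp: orthonormal_basis_def)
  then show "independent B"
    using B pairwise_orthogonal_independent unfolding orthonormal_basis_def by blast
  then show "finite B" by (rule independent_imp_finite)
qed

lemma orthonormal_basis_sum: "(\<Sum>b\<in>B. (x \<bullet> b) *\<^sub>R b) = x"
  using B finite_orthonormal_basis
  by (intro orthonormal_basis_expand) (auto simp: orthonormal_basis_def)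

lemma inner_orthonormal_basis: "a \<in> B \<Longrightarrow> b \<in> B \<Longrightarrow> a \<bullet> b = (if a = b then 1 else 0)"
  using B by (auto simp: orthonormal_basis_def pairwise_def orthogonal_def dot_square_norm)

lemma inner_eq_sum_orthonormal_basis: "x \<bullet> y = (\<Sum>b\<in>B. (x \<bullet> b) * (y \<bullet> b))"
  by (subst (1) orthonormal_basis_sum[of x, symmetric])
    (simp add: inner_sum_left inner_commute[of y])

lemma trace_orthonormal_basis:
  assumes "linear f"
  shows "trace_of f = (\<Sum>b\<in>B. f b \<bullet> b)"
proof -
  interpret f: linear f by fact
  have "(\<Sum>b\<in>B. f b \<bullet> b) = (\<Sum>b\<in>B. \<Sum>i\<in>Basis. (b \<bullet> i) * (f i \<bullet> b))"
    by (subst (1) euclidean_representation[symmetric], subst f.sum)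
      (simp add: f.scaleR inner_sum_left)
  also have "\<dots> = (\<Sum>i\<in>Basis. \<Sum>b\<in>B. (f i \<bullet> b) * (i \<bullet> b))"
    by (subst sum.swap) (simp add: mult.commute inner_commute)
  also have "\<dots> = (\<Sum>i\<in>Basis. f i \<bullet> i)"
    by (simp flip: inner_eq_sum_orthonormal_basis)
  finally show ?thesis by (simp add: trace_of_def)
qed

text \<open>This turns the multiplicities of the theorem, which are dimensions of eigenspaces, into counts of basis
vectors, and such counts can be read off from traces.\<close>

lemma dim_eigenspace:
  assumes "linear f" "\<And>b. b \<in> B \<Longrightarrow> f b = ev b *\<^sub>R b"
  shows "dim {y. f y = \<mu> *\<^sub>R y} = card {b \<in> B. ev b = \<mu>}"
proof -
  interpret f: linear f by fact
  have "{y. f y = \<mu> *\<^sub>R y} = span {b \<in> B. ev b = \<mu>}"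
  proof
    show "span {b \<in> B. ev b = \<mu>} \<subseteq> {y. f y = \<mu> *\<^sub>R y}"
      by (intro span_minimal) (auto simp: assms(2) subspace_def f.zero f.add f.scaleR algebra_simps)
    show "{y. f y = \<mu> *\<^sub>R y} \<subseteq> span {b \<in> B. ev b = \<mu>}"
    proof
      fix y assume "y \<in> {y. f y = \<mu> *\<^sub>R y}"
      then have y: "f y = \<mu> *\<^sub>R y" by simp
      have coeff: "y \<bullet> b = 0" if "b \<in> B" "ev b \<noteq> \<mu>" for b
      proof -
        have "f y = (\<Sum>a\<in>B. ((y \<bullet> a) * ev a) *\<^sub>R a)"
          by (subst (1) orthonormal_basis_sum[of y, symmetric]) (simp add: f.sum f.scaleR assms(2))
        then have "f y \<bullet> b = (\<Sum>a\<in>B. ((y \<bullet> a) * ev a) * (a \<bullet> b))"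
          by (simp add: inner_sum_left)
        also have "\<dots> = (y \<bullet> b) * ev b"
          using that(1) finite_orthonormal_basis
          by (simp add: inner_orthonormal_basis if_distrib[of "(*) _"] cong: if_cong)
        finally show ?thesis using that(2) y by simp
      qed
      have "y = (\<Sum>b\<in>{b \<in> B. ev b = \<mu>}. (y \<bullet> b) *\<^sub>R b)"
        by (subst (1) orthonormal_basis_sum[of y, symmetric])
          (intro sum.mono_neutral_right; use finite_orthonormal_basis coeff in auto)
      then show "y \<in> span {b \<in> B. ev b = \<mu>}"
        by (metis (no_types, lifting) span_base span_scale span_sum)
    qed
  qed
  moreover have "independent {b \<in> B. ev b = \<mu>}"
    using independent_orthonormal_basis by (rule independent_mono) auto
  ultimately show ?thesis
    by (simp add: dim_eq_card_independent)
qed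

end

text \<open>\<open>h\<close> is \<open>f\<^bsup>-1/2\<^esup>\<close>, defined on an orthonormal eigenbasis of \<open>f\<close>.\<close>

lemma inner_product_normal_form:
  fixes f :: "'a::euclidean_space \<Rightarrow> 'a"
  assumes f: "linear f" "\<And>x y. f x \<bullet> y = x \<bullet> f y" and pos: "\<And>x. x \<noteq> 0 \<Longrightarrow> 0 < x \<bullet> f x"
  obtains h :: "'a \<Rightarrow> 'a" where "linear h" "\<And>x y. h x \<bullet> f (h y) = x \<bullet> y"
proof -
  obtain B ev where B: "orthonormal_basis B" "\<And>b. b \<in> B \<Longrightarrow> f b = ev b *\<^sub>R b"
    using selfadjoint_eigenbasis[OF f] by blast
  note ONB = inner_orthonormal_basis[OF B(1)] finite_orthonormal_basis[OF B(1)]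
  have ev: "0 < ev b" if "b \<in> B" for b
  proof -
    have "b \<noteq> 0" using ONB(1)[OF that that] by auto
    then show ?thesis using pos[of b] B(2)[OF that] ONB(1)[OF that that] by simp
  qed
  define h where "h x = (\<Sum>b\<in>B. (x \<bullet> b / sqrt (ev b)) *\<^sub>R b)" for x
  have "linear h"
    by (intro linearI) (simp_all add: h_def inner_add_left add_divide_distrib scaleR_add_left sum.distrib
        scaleR_sum_right)
  moreover have "h x \<bullet> f (h y) = x \<bullet> y" for x y
  proof -
    have h_inner: "h x \<bullet> b = x \<bullet> b / sqrt (ev b)" if "b \<in> B" for x b
      using that ONB by (simp add: h_def inner_sum_left if_distrib[of "(*) _"] cong: if_cong)
    have "h x \<bullet> f (h y) = (\<Sum>b\<in>B. (h x \<bullet> b) * (f (h y) \<bullet> b))"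
      by (rule inner_eq_sum_orthonormal_basis[OF B(1)])
    also have "\<dots> = (\<Sum>b\<in>B. (x \<bullet> b) * (y \<bullet> b))"
    proof (rule sum.cong[OF refl])
      fix b assume b: "b \<in> B"
      show "(h x \<bullet> b) * (f (h y) \<bullet> b) = (x \<bullet> b) * (y \<bullet> b)"
        using ev[OF b] by (simp add: f(2) B(2)[OF b] h_inner[OF b])
    qed
    also have "\<dots> = x \<bullet> y"
      by (rule inner_eq_sum_orthonormal_basis[OF B(1), symmetric])
    finally show ?thesis .
  qed
  ultimately show ?thesis by (rule that)
qed

section \<open>Polynomials of self-adjoint operators\<close>

text \<open>The operator \<open>(f - a\<^sub>1) \<dots> (f - a\<^sub>n)\<close>. Products of linear factors are all the polynomials that are
needed: such a product is the minimal polynomial of a self-adjoint operator, and choosing all eigenvalues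
but one singles out the remaining eigenspace.\<close>

primrec linear_factors :: "('a::real_vector \<Rightarrow> 'a) \<Rightarrow> real list \<Rightarrow> 'a \<Rightarrow> 'a"
  where
    "linear_factors f [] y = y"
  | "linear_factors f (a # as) y = f (linear_factors f as y) - a *\<^sub>R linear_factors f as y"

lemma linear_linear_factors:
  assumes "linear f" shows "linear (linear_factors f as)"
proof (induction as)
  case Nil
  show ?case by (simp add: linear_iff)
next
  case (Cons a as)
  then show ?case
    using linear_compose[OF Cons assms] by (auto simp: o_def linear_iff algebra_simps)
qed

lemma linear_factors_eigenvector:
  assumes "linear f" "f y = \<mu> *\<^sub>R y"
  shows "linear_factors f as y = (\<Prod>a\<leftarrow>as. \<mu> - a) *\<^sub>R y"
proof (induction as)
  case (Cons a as)
  interpret f: linear f by fact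
  show ?case by (simp add: Cons f.scaleR assms(2) algebra_simps)
qed simp

lemma linear_factors_eq_0:
  assumes B: "orthonormal_basis B" "\<And>b. b \<in> B \<Longrightarrow> f b = ev b *\<^sub>R b" and "linear f" "ev ` B \<subseteq> set as"
  shows "linear_factors f as y = 0"
proof -
  interpret P: linear "linear_factors f as" using \<open>linear f\<close> by (rule linear_linear_factors)
  have "linear_factors f as b = 0" if "b \<in> B" for b
    using that assms(4) prod_list_zero_iff[of "map (\<lambda>a. ev b - a) as"]
    by (auto simp: linear_factors_eigenvector[OF \<open>linear f\<close> B(2)])
  then have "linear_factors f as (\<Sum>b\<in>B. (y \<bullet> b) *\<^sub>R b) = 0"
    by (simp add: P.sum P.scaleR)
  then show ?thesis by (simp add: orthonormal_basis_sum[OF B(1)])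
qed

text \<open>In an eigenbasis, the trace of \<open>\<Prod>(f - a)\<close> is the sum of \<open>\<Prod>(\<nu> - a)\<close> over the eigenvalues \<open>\<nu>\<close>. If
\<open>a\<close> runs through all eigenvalues of \<open>f\<close> and of \<open>g\<close> other than \<open>\<mu>\<close>, only the terms with \<open>\<nu> = \<mu>\<close> survive, each
with the same nonzero value \<open>c\<close>; the trace therefore counts the multiplicity of \<open>\<mu>\<close>.\<close>

lemma same_traces_imp_same_multiplicities:
  fixes f g :: "'a::euclidean_space \<Rightarrow> 'a"
  assumes f: "linear f" "\<And>x y. f x \<bullet> y = x \<bullet> f y" and g: "linear g" "\<And>x y. g x \<bullet> y = x \<bullet> g y"
    and traces: "\<And>as. trace_of (linear_factors f as) = trace_of (linear_factors g as)"
  shows "dim {y. f y = \<mu> *\<^sub>R y} = dim {y. g y = \<mu> *\<^sub>R y}"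
proof -
  obtain B ev where B: "orthonormal_basis B" "\<And>b. b \<in> B \<Longrightarrow> f b = ev b *\<^sub>R b"
    using selfadjoint_eigenbasis[OF f] by blast
  obtain C ew where C: "orthonormal_basis C" "\<And>b. b \<in> C \<Longrightarrow> g b = ew b *\<^sub>R b"
    using selfadjoint_eigenbasis[OF g] by blast
  note fin = finite_orthonormal_basis[OF B(1)] finite_orthonormal_basis[OF C(1)]
  obtain as where as: "set as = (ev ` B \<union> ew ` C) - {\<mu>}"
    using fin by (meson finite_Diff finite_UnI finite_imageI finite_list)
  define c where "c = (\<Prod>a\<leftarrow>as. \<mu> - a)"
  have "c \<noteq> 0" by (auto simp: c_def prod_list_zero_iff as)
  have count: "trace_of (linear_factors h as) = card {b \<in> D. e b = \<mu>} * c"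
    if D: "orthonormal_basis D" "\<And>b. b \<in> D \<Longrightarrow> h b = e b *\<^sub>R b"
      and h: "linear h" "e ` D \<subseteq> insert \<mu> (set as)" for h D e
  proof -
    have D1: "b \<bullet> b = 1" if "b \<in> D" for b using inner_orthonormal_basis[OF D(1) that that] by simp
    have "trace_of (linear_factors h as) = (\<Sum>b\<in>D. linear_factors h as b \<bullet> b)"
      by (rule trace_orthonormal_basis[OF D(1) linear_linear_factors[OF h(1)]])
    also have "\<dots> = (\<Sum>b\<in>D. if e b = \<mu> then c else 0)"
    proof (rule sum.cong[OF refl])
      fix b assume "b \<in> D"
      then have "linear_factors h as b \<bullet> b = (\<Prod>a\<leftarrow>as. e b - a)"
        using D1 by (simp add: linear_factors_eigenvector[OF h(1) D(2)])
      also have "\<dots> = (if e b = \<mu> then c else 0)"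
        using \<open>b \<in> D\<close> h(2) by (auto simp: c_def prod_list_zero_iff)
      finally show "linear_factors h as b \<bullet> b = (if e b = \<mu> then c else 0)" .
    qed
    also have "\<dots> = card {b \<in> D. e b = \<mu>} * c"
      using finite_orthonormal_basis[OF D(1)] by (simp add: sum.If_cases Int_def)
    finally show ?thesis .
  qed
  have "card {b \<in> B. ev b = \<mu>} = card {b \<in> C. ew b = \<mu>}"
  proof -
    have "ev ` B \<subseteq> insert \<mu> (set as)" "ew ` C \<subseteq> insert \<mu> (set as)" unfolding as by blast+
    from count[OF B f(1) this(1)] count[OF C g(1) this(2)] show ?thesis
      using traces[of as] \<open>c \<noteq> 0\<close> by simp
  qed
  then show ?thesis
    by (simp add: dim_eigenspace[OF B(1) f(1) B(2)] dim_eigenspace[OF C(1) g(1) C(2)])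
qed

text \<open>First-order perturbation of an eigenvector. Here \<open>F'\<close> is the derivative at \<open>t\<close> of the family \<open>F\<close> of
operators, described by the product rule that it satisfies. In the derivative of \<open>\<Prod>(F s - a) y\<close>, paired with
\<open>y\<close>, self-adjointness moves every factor of \<open>F t\<close> onto the eigenvector \<open>y\<close>; what remains is a multiple
of \<open>F' y \<bullet> y\<close>.\<close>

lemma linear_factors_derivative:
  fixes F :: "real \<Rightarrow> 'a::real_inner \<Rightarrow> 'a"
  assumes deriv: "\<And>v v'. (v has_vector_derivative v') (at t) \<Longrightarrow>
      ((\<lambda>s. F s (v s)) has_vector_derivative F t v' + F' (v t)) (at t)"
    and lin: "linear (F t)" "linear F'"
    and self_adjoint: "\<And>x y. F t x \<bullet> y = x \<bullet> F t y"
    and eigen: "F t y = \<mu> *\<^sub>R y"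
  shows "\<exists>w. ((\<lambda>s. linear_factors (F s) as y) has_vector_derivative w) (at t) \<and>
             (F' y \<bullet> y = 0 \<longrightarrow> w \<bullet> y = 0)"
proof (induction as)
  case Nil
  show ?case by (intro exI[of _ 0]) auto
next
  case (Cons a as)
  then obtain w where w: "((\<lambda>s. linear_factors (F s) as y) has_vector_derivative w) (at t)"
    "F' y \<bullet> y = 0 \<Longrightarrow> w \<bullet> y = 0" by blast
  define c where "c = (\<Prod>a\<leftarrow>as. \<mu> - a)"
  have value_t: "linear_factors (F t) as y = c *\<^sub>R y"
    unfolding c_def by (rule linear_factors_eigenvector[OF lin(1) eigen])
  have "((\<lambda>s. linear_factors (F s) (a # as) y) has_vector_derivative
      F t w + F' (c *\<^sub>R y) - a *\<^sub>R w) (at t)"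
    using w(1) deriv[OF w(1)] by (auto intro!: derivative_eq_intros simp: value_t)
  moreover have "(F t w + F' (c *\<^sub>R y) - a *\<^sub>R w) \<bullet> y = 0" if "F' y \<bullet> y = 0"
    using that w(2) by (simp add: inner_add_left inner_diff_left self_adjoint eigen linear_cmul[OF lin(2)])
  ultimately show ?case by blast
qed

section \<open>Great circles\<close>

definition arc :: "'a::real_inner \<Rightarrow> 'a \<Rightarrow> real \<Rightarrow> 'a"
  where "arc x z t = cos t *\<^sub>R x + sin t *\<^sub>R z"

definition arc_velocity :: "'a::real_inner \<Rightarrow> 'a \<Rightarrow> real \<Rightarrow> 'a"
  where "arc_velocity x z t = cos t *\<^sub>R z - sin t *\<^sub>R x"

lemma norm_arc:
  fixes x z :: "'a::real_inner"
  assumes "norm x = 1" "norm z = 1" "x \<bullet> z = 0"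
  shows "norm (arc x z t) = 1" "arc x z t \<bullet> arc_velocity x z t = 0"
proof -
  have "x \<bullet> x = 1" "z \<bullet> z = 1" using assms by (auto simp: dot_square_norm)
  then show "norm (arc x z t) = 1" "arc x z t \<bullet> arc_velocity x z t = 0"
    using assms(3) sin_cos_squared_add[of t]
    by (auto simp: norm_eq_1 arc_def arc_velocity_def inner_add_left inner_add_right inner_diff_right
        inner_commute[of z x] power2_eq_square algebra_simps)
qed

lemma unit_vectors_on_arc:
  fixes x x' :: "'a::real_inner"
  assumes "norm x = 1" "norm x' = 1"
  obtains (minus) "x' = x \<or> x' = - x" | (arc) z t where "norm z = 1" "x \<bullet> z = 0" "x' = arc x z t"
proof (cases "x' = (x \<bullet> x') *\<^sub>R x")
  case True
  then have "\<bar>x \<bullet> x'\<bar> = 1" using assms by (metis norm_scaleR mult.right_neutral)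
  then show ?thesis using True minus by (metis abs_eq_iff' scaleR_minus1_left scaleR_one abs_1)
next
  case False
  define c s where "c = x \<bullet> x'" and "s = norm (x' - c *\<^sub>R x)"
  define z where "z = (x' - c *\<^sub>R x) /\<^sub>R s"
  have s: "s \<noteq> 0" using False by (simp add: s_def c_def)
  have xx: "x \<bullet> x = 1" "x' \<bullet> x' = 1" using assms by (auto simp: dot_square_norm)
  have z: "norm z = 1" "x \<bullet> z = 0" "x' = c *\<^sub>R x + s *\<^sub>R z"
    using s xx by (auto simp: z_def s_def inner_diff_right c_def)
  then have zz: "z \<bullet> z = 1" by (simp add: dot_square_norm)
  have "x' \<bullet> x' = c\<^sup>2 + s\<^sup>2"
    by (subst (1 2) z(3)) (simp add: inner_add_left inner_add_right xx zz z(2)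
        inner_commute[of z x] power2_eq_square)
  then obtain t where "c = cos t" "s = sin t"
    using xx sincos_total_2pi by metis
  then show ?thesis using arc[OF z(1,2)] z(3) by (simp add: arc_def)
qed

section \<open>The Osserman condition and duality for an algebraic curvature tensor\<close>

definition jac :: "('a \<Rightarrow> 'a \<Rightarrow> 'a \<Rightarrow> 'a) \<Rightarrow> 'a \<Rightarrow> 'a \<Rightarrow> 'a"
  where "jac R x y = R y x x"

definition osserman :: "('a::euclidean_space \<Rightarrow> 'a \<Rightarrow> 'a \<Rightarrow> 'a) \<Rightarrow> bool"
  where "osserman R \<longleftrightarrow> (\<forall>x x' \<mu>. norm x = 1 \<longrightarrow> norm x' = 1 \<longrightarrow>
    dim {y. jac R x y = \<mu> *\<^sub>R y} = dim {y. jac R x' y = \<mu> *\<^sub>R y})"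

definition duality :: "('a::euclidean_space \<Rightarrow> 'a \<Rightarrow> 'a \<Rightarrow> 'a) \<Rightarrow> bool"
  where "duality R \<longleftrightarrow> (\<forall>x y \<mu>. norm x = 1 \<longrightarrow> norm y = 1 \<longrightarrow>
    jac R x y = \<mu> *\<^sub>R y \<longrightarrow> jac R y x = \<mu> *\<^sub>R x)"

text \<open>\<open>R x y z\<close> is the curvature operator \<open>R(x, y)z\<close> of one tangent space, identified with a Euclidean
space. The skew symmetry in \<open>z\<close> and \<open>w\<close> of \<open>R x y z \<bullet> w\<close> follows from the two symmetries assumed.\<close>

locale curvature_tensor =
  fixes R :: "'a::euclidean_space \<Rightarrow> 'a \<Rightarrow> 'a \<Rightarrow> 'a"
  assumes linear_1: "linear (\<lambda>x. R x y z)"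
    and linear_2: "linear (\<lambda>y. R x y z)"
    and linear_3: "linear (\<lambda>z. R x y z)"
    and skew: "R x y z = - R y x z"
    and pair_symmetric: "R x y z \<bullet> w = R z w x \<bullet> y"
begin

lemma skew_adjoint: "R x y z \<bullet> w = - (R x y w \<bullet> z)"
  by (metis pair_symmetric skew inner_minus_left)

lemma linear_jac: "linear (jac R x)"
  unfolding jac_def by (rule linear_1)

lemma jac_self_adjoint: "jac R x y \<bullet> z = y \<bullet> jac R x z"
proof -
  have "R y x x \<bullet> z = R x z y \<bullet> x" by (rule pair_symmetric)
  also have "\<dots> = R z x x \<bullet> y" by (metis skew skew_adjoint inner_minus_left)
  finally show ?thesis by (simp add: jac_def inner_commute)
qed

text \<open>The derivative of \<open>x \<mapsto> jac R x y\<close> in the direction \<open>z\<close>.\<close>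

definition jac_polar :: "'a \<Rightarrow> 'a \<Rightarrow> 'a \<Rightarrow> 'a"
  where "jac_polar x z y = R y x z + R y z x"

lemma linear_jac_polar: "linear (jac_polar x z)"
  unfolding jac_polar_def by (intro linear_compose_add linear_1)

text \<open>The identity that ties duality to the Osserman condition. If \<open>y\<close> is a unit eigenvector of \<open>jac R x\<close>, the
left-hand side is the first-order change of its eigenvalue as \<open>x\<close> moves in the direction \<open>z\<close>; the
right-hand side vanishes for all \<open>z\<close> orthogonal to \<open>x\<close> exactly if \<open>x\<close> is an eigenvector of \<open>jac R y\<close>.\<close>

lemma jac_polar_inner: "jac_polar x z y \<bullet> y = 2 * (jac R y x \<bullet> z)"
proof -
  have "R y x z \<bullet> y = jac R y x \<bullet> z"
    by (metis jac_def jac_self_adjoint inner_commute pair_symmetric)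
  moreover have "R y z x \<bullet> y = jac R y x \<bullet> z"
    by (metis jac_def pair_symmetric)
  ultimately show ?thesis by (simp add: jac_polar_def inner_add_left)
qed

lemma jac_arc:
  "jac R (arc x z t) y =
     (cos t)\<^sup>2 *\<^sub>R jac R x y + (cos t * sin t) *\<^sub>R jac_polar x z y + (sin t)\<^sup>2 *\<^sub>R jac R z y"
  by (simp add: jac_def jac_polar_def arc_def linear_add[OF linear_2] linear_cmul[OF linear_2]
      linear_add[OF linear_3] linear_cmul[OF linear_3] algebra_simps power2_eq_square)

lemma jac_arc_derivative:
  assumes v: "(v has_vector_derivative v') (at t)"
  shows "((\<lambda>s. jac R (arc x z s) (v s)) has_vector_derivative
     jac R (arc x z t) v' + jac_polar (arc x z t) (arc_velocity x z t) (v t)) (at t)"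
proof -
  note bl = linear_linear[THEN iffD2, THEN bounded_linear.has_vector_derivative, OF _ v]
  have polar: "jac_polar (arc x z t) (arc_velocity x z t) y = (- (cos t * sin t + cos t * sin t)) *\<^sub>R jac R x y
      + (cos t * cos t - sin t * sin t) *\<^sub>R jac_polar x z y + (cos t * sin t + cos t * sin t) *\<^sub>R jac R z y" for y
    by (simp add: jac_def jac_polar_def arc_def arc_velocity_def
        linear_add[OF linear_2] linear_diff[OF linear_2] linear_cmul[OF linear_2]
        linear_add[OF linear_3] linear_diff[OF linear_3] linear_cmul[OF linear_3] algebra_simps)
      (rule euclidean_eqI, simp add: inner_add_left algebra_simps)
  have c: "((\<lambda>s. (cos s)\<^sup>2) has_real_derivative - (cos t * sin t + cos t * sin t)) (at t)"
    and cs: "((\<lambda>s. cos s * sin s) has_real_derivative cos t * cos t - sin t * sin t) (at t)"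
    and s: "((\<lambda>s. (sin s)\<^sup>2) has_real_derivative cos t * sin t + cos t * sin t) (at t)"
    by (auto intro!: derivative_eq_intros)
  note d = has_vector_derivative_add[OF has_vector_derivative_add[OF
        has_vector_derivative_scaleR[OF c bl[OF linear_jac[of x]]]
        has_vector_derivative_scaleR[OF cs bl[OF linear_jac_polar[of x z]]]]
        has_vector_derivative_scaleR[OF s bl[OF linear_jac[of z]]]]
  show ?thesis
    unfolding jac_arc polar using d by (simp add: algebra_simps)
qed

text \<open>At each point of the circle the trace is computed in an eigenbasis of the Jacobi operator at that point;
the basis is then kept fixed while differentiating. By duality and \<open>jac_polar_inner\<close>, every diagonal entry
has derivative zero there. Nothing has to be known about how eigenvalues and eigenvectors vary along the circle,
in particular where multiplicities change.\<close>

lemma trace_constant_on_arc: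
  assumes "duality R" and xz: "norm x = 1" "norm z = 1" "x \<bullet> z = 0"
  shows "trace_of (linear_factors (jac R (arc x z t)) as) = trace_of (linear_factors (jac R x) as)"
proof -
  have "((\<lambda>t. trace_of (linear_factors (jac R (arc x z t)) as)) has_real_derivative 0) (at t)" for t
  proof -
    let ?F = "\<lambda>s. jac R (arc x z s)"
    let ?F' = "jac_polar (arc x z t) (arc_velocity x z t)"
    obtain B ev where B: "orthonormal_basis B" "\<And>b. b \<in> B \<Longrightarrow> ?F t b = ev b *\<^sub>R b"
      using selfadjoint_eigenbasis[OF linear_jac jac_self_adjoint] by blast
    have "\<exists>w. ((\<lambda>s. linear_factors (?F s) as b) has_vector_derivative w) (at t) \<and> w \<bullet> b = 0"
      if "b \<in> B" for b
    proof -
      have "norm b = 1" using B(1) that by (simp add: orthonormal_basis_def)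
      with \<open>duality R\<close> B(2)[OF that] have "jac R b (arc x z t) = ev b *\<^sub>R arc x z t"
        unfolding duality_def using norm_arc(1)[OF xz] by blast
      then have "?F' b \<bullet> b = 0"
        using norm_arc(2)[OF xz] by (simp add: jac_polar_inner)
      then show ?thesis
        using linear_factors_derivative[of t ?F ?F' b "ev b" as, OF jac_arc_derivative linear_jac
            linear_jac_polar jac_self_adjoint B(2)[OF that]] by blast
    qed
    then obtain w where w: "\<And>b. b \<in> B \<Longrightarrow>
        ((\<lambda>s. linear_factors (?F s) as b) has_vector_derivative w b) (at t)"
      "\<And>b. b \<in> B \<Longrightarrow> w b \<bullet> b = 0" by metis
    have "((\<lambda>s. \<Sum>b\<in>B. linear_factors (?F s) as b \<bullet> b) has_vector_derivative (\<Sum>b\<in>B. w b \<bullet> b)) (at t)"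
      using w(1) by (intro has_vector_derivative_sum
          bounded_linear.has_vector_derivative[OF bounded_linear_inner_left]) auto
    then show ?thesis
      using w(2)
      by (simp add: has_real_derivative_iff_has_vector_derivative
          trace_orthonormal_basis[OF B(1) linear_linear_factors[OF linear_jac]])
  qed
  then have "trace_of (linear_factors (jac R (arc x z t)) as) =
      trace_of (linear_factors (jac R (arc x z 0)) as)"
    using DERIV_isconst_all[of "\<lambda>t. trace_of (linear_factors (jac R (arc x z t)) as)" t 0] by blast
  then show ?thesis by (simp add: arc_def)
qed

lemma duality_imp_osserman:
  assumes "duality R" shows "osserman R"
  unfolding osserman_def
proof (intro allI impI)
  fix x x' :: 'a and \<mu>
  assume x: "norm x = 1" "norm x' = 1"
  have even: "jac R (- x) = jac R x"
    by (simp add: fun_eq_iff jac_def linear_neg[OF linear_2] linear_neg[OF linear_3])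
  have "trace_of (linear_factors (jac R x) as) = trace_of (linear_factors (jac R x') as)" for as
    by (rule unit_vectors_on_arc[OF x])
      (use x in \<open>auto simp: even trace_constant_on_arc[OF assms]\<close>)
  then show "dim {y. jac R x y = \<mu> *\<^sub>R y} = dim {y. jac R x' y = \<mu> *\<^sub>R y}"
    by (intro same_traces_imp_same_multiplicities linear_jac jac_self_adjoint)
qed

text \<open>Let \<open>p\<close> be the product of \<open>T - a\<close> over the eigenvalues \<open>a\<close> of one Jacobi operator. By the Osserman
condition \<open>p\<close> annihilates the Jacobi operators of all unit vectors. Write \<open>p = (T - \<mu>) q\<close>, where
\<open>q\<close> does not vanish at \<open>\<mu>\<close>. Along a great circle through \<open>x\<close>, the number
\<open>q(J) y \<bullet> (J - \<mu>) y = p(J) y \<bullet> y\<close> is identically zero; since \<open>(J - \<mu>) y = 0\<close> at \<open>x\<close>, its derivative is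
\<open>q(\<mu>) (J' y \<bullet> y)\<close>, so that \<open>J' y \<bullet> y = 0\<close>, and \<open>jac_polar_inner\<close> applies.\<close>

lemma osserman_imp_duality:
  assumes "osserman R" shows "duality R"
  unfolding duality_def
proof (intro allI impI)
  fix x y :: 'a and \<mu>
  assume x: "norm x = 1" and y: "norm y = 1" and eigen: "jac R x y = \<mu> *\<^sub>R y"
  obtain B ev where B: "orthonormal_basis B" "\<And>b. b \<in> B \<Longrightarrow> jac R x b = ev b *\<^sub>R b"
    using selfadjoint_eigenbasis[OF linear_jac jac_self_adjoint] by blast
  obtain as where as: "set as = ev ` B - {\<mu>}"
    using finite_orthonormal_basis[OF B(1)] by (meson finite_Diff finite_imageI finite_list)
  have annihilates: "linear_factors (jac R x') (\<mu> # as) v = 0" if x': "norm x' = 1" for x' v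
  proof -
    obtain C ew where C: "orthonormal_basis C" "\<And>b. b \<in> C \<Longrightarrow> jac R x' b = ew b *\<^sub>R b"
      using selfadjoint_eigenbasis[OF linear_jac jac_self_adjoint] by blast
    have "ew c \<in> ev ` B" if "c \<in> C" for c
    proof -
      have "card {b \<in> C. ew b = ew c} = card {b \<in> B. ev b = ew c}"
        using \<open>osserman R\<close>[unfolded osserman_def, rule_format, OF x' x, of "ew c"]
        by (simp only: dim_eigenspace[OF C(1) linear_jac C(2)] dim_eigenspace[OF B(1) linear_jac B(2)])
      moreover have "card {b \<in> C. ew b = ew c} \<noteq> 0"
        using that finite_orthonormal_basis[OF C(1)] by auto
      ultimately have "{b \<in> B. ev b = ew c} \<noteq> {}" by (metis card.empty)
      then obtain b where "b \<in> B" "ev b = ew c" by blast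
      then show ?thesis by (metis imageI)
    qed
    then show ?thesis
      by (intro linear_factors_eq_0[OF C linear_jac]) (auto simp: as)
  qed
  have orth: "jac R y x \<bullet> z = 0" if z: "norm z = 1" "x \<bullet> z = 0" for z
  proof -
    let ?F = "\<lambda>s. jac R (arc x z s)"
    let ?F' = "jac_polar (arc x z 0) (arc_velocity x z 0)"
    have eigen0: "?F 0 y = \<mu> *\<^sub>R y" using eigen by (simp add: arc_def)
    obtain w where w: "((\<lambda>s. linear_factors (?F s) as y) has_vector_derivative w) (at 0)"
      using linear_factors_derivative[of 0 ?F ?F' y \<mu> as, OF jac_arc_derivative linear_jac
          linear_jac_polar jac_self_adjoint eigen0] by blast
    have v: "((\<lambda>s. ?F s y) has_vector_derivative ?F' y) (at 0)"
      using jac_arc_derivative[of "\<lambda>_. y" 0 0 x z] linear_0[OF linear_jac] by simp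
    define c where "c = (\<Prod>a\<leftarrow>as. \<mu> - a)"
    have "c \<noteq> 0" by (auto simp: c_def prod_list_zero_iff as)
    have value_0: "linear_factors (?F 0) as y = c *\<^sub>R y"
      unfolding c_def by (rule linear_factors_eigenvector[OF linear_jac eigen0])
    have "((\<lambda>s. linear_factors (?F s) as y \<bullet> (?F s y - \<mu> *\<^sub>R y)) has_vector_derivative
        linear_factors (?F 0) as y \<bullet> (?F' y - 0) + w \<bullet> (?F 0 y - \<mu> *\<^sub>R y)) (at 0)"
      by (intro bounded_bilinear.has_vector_derivative[OF bounded_bilinear_inner]
          has_vector_derivative_diff w v has_vector_derivative_const)
    moreover have "linear_factors (?F s) as y \<bullet> (?F s y - \<mu> *\<^sub>R y) = 0" for s
      using annihilates[OF norm_arc(1)[OF x z], of s y]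
      by (simp add: inner_diff_right flip: jac_self_adjoint)
    ultimately have "((\<lambda>s. 0::real) has_vector_derivative c * (?F' y \<bullet> y)) (at 0)"
      by (simp add: eigen0 value_0 inner_commute)
    then have "c * (?F' y \<bullet> y) = 0"
      using has_vector_derivative_const vector_derivative_unique_at by blast
    then show ?thesis
      using \<open>c \<noteq> 0\<close> by (simp add: jac_polar_inner arc_def arc_velocity_def)
  qed
  \<comment> \<open>\<open>jac R y x\<close> is orthogonal to everything orthogonal to \<open>x\<close>, hence equals its projection onto \<open>x\<close>.\<close>
  define r where "r = jac R y x - (x \<bullet> jac R y x) *\<^sub>R x"
  have xx: "x \<bullet> x = 1" "y \<bullet> y = 1" using x y by (auto simp: dot_square_norm)
  have "x \<bullet> r = 0" by (simp add: r_def inner_diff_right xx)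
  have "r = 0"
  proof (rule ccontr)
    assume "r \<noteq> 0"
    then have "jac R y x \<bullet> (r /\<^sub>R norm r) = 0"
      using \<open>x \<bullet> r = 0\<close> by (intro orth) auto
    then have "jac R y x \<bullet> r = 0" using \<open>r \<noteq> 0\<close> by simp
    then have "r \<bullet> r = 0" using \<open>x \<bullet> r = 0\<close> by (subst (1) r_def) (simp add: inner_diff_left)
    with \<open>r \<noteq> 0\<close> show False by simp
  qed
  moreover have "x \<bullet> jac R y x = \<mu>"
  proof -
    have "x \<bullet> jac R y x = jac R x y \<bullet> y"
      by (metis jac_def pair_symmetric inner_commute)
    then show ?thesis by (simp add: eigen xx)
  qed
  ultimately show "jac R y x = \<mu> *\<^sub>R x" by (simp add: r_def)
qed

theorem osserman_iff_duality: "osserman R \<longleftrightarrow> duality R"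
  using osserman_imp_duality duality_imp_osserman by blast

end

(* The algebraic half is complete: it rests on the eigenbasis theorem and the perturbation lemma. *)
thm_deps curvature_tensor.osserman_iff_duality

section \<open>Partial derivatives of smooth functions\<close>

lemma partial_eq:
  "(f has_derivative f') (at u) \<Longrightarrow> partial i f u = f' (axis i 1)"
  unfolding partial_def by (metis frechet_derivative_at)

lemma partial_add:
  assumes "f differentiable at u" "h differentiable at u"
  shows "partial i (\<lambda>u. f u + h u) u = partial i f u + partial i h u"
  unfolding partial_eq[OF has_derivative_add[OF assms[unfolded frechet_derivative_works]]]
  by (simp add: partial_def)

lemma partial_diff:
  assumes "f differentiable at u" "h differentiable at u"
  shows "partial i (\<lambda>u. f u - h u) u = partial i f u - partial i h u"
  unfolding partial_eq[OF has_derivative_diff[OF assms[unfolded frechet_derivative_works]]]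
  by (simp add: partial_def)

lemma partial_mult:
  fixes f h :: "real^'n::finite \<Rightarrow> real"
  assumes "f differentiable at u" "h differentiable at u"
  shows "partial i (\<lambda>u. f u * h u) u = partial i f u * h u + f u * partial i h u"
  unfolding partial_eq[OF has_derivative_mult[OF assms[unfolded frechet_derivative_works]]]
  by (simp add: partial_def)

lemma partial_divide_const:
  fixes f :: "real^'n::finite \<Rightarrow> real"
  assumes "f differentiable at u"
  shows "partial i (\<lambda>u. f u / k) u = partial i f u / k"
  unfolding divide_inverse
    partial_eq[OF has_derivative_mult_left[OF assms[unfolded frechet_derivative_works]]]
  by (simp add: partial_def)

lemma partial_sum:
  assumes "\<And>a. a \<in> I \<Longrightarrow> f a differentiable at u"
  shows "partial i (\<lambda>u. \<Sum>a\<in>I. f a u) u = (\<Sum>a\<in>I. partial i (f a) u)"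
proof -
  have "((\<lambda>u. \<Sum>a\<in>I. f a u) has_derivative (\<lambda>v. \<Sum>a\<in>I. frechet_derivative (f a) (at u) v)) (at u)"
    using assms by (intro has_derivative_sum) (simp flip: frechet_derivative_works)
  from partial_eq[OF this] show ?thesis by (simp add: partial_def)
qed

lemma partial_cong_on_open:
  assumes "f differentiable at u" "open U" "u \<in> U" "\<And>v. v \<in> U \<Longrightarrow> f v = h v"
  shows "partial i f u = partial i h u"
  using frechet_derivative_transform_within_open[OF assms] by (simp add: partial_def)

lemma smooth_on_partial: "smooth_on U f \<Longrightarrow> smooth_on U (partial i f)"
  unfolding smooth_on_def by (metis C_k_on.simps(2))

lemma smooth_on_imp_continuous_on: "smooth_on U f \<Longrightarrow> continuous_on U f"
  unfolding smooth_on_def by (metis C_k_on.simps(1))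

lemma smooth_on_imp_differentiable:
  "smooth_on U f \<Longrightarrow> open U \<Longrightarrow> u \<in> U \<Longrightarrow> f differentiable at u"
  unfolding smooth_on_def by (metis C_k_on.simps(2) differentiable_on_eq_differentiable_at)

lemma has_real_derivative_along_axis:
  fixes f :: "real^'n::finite \<Rightarrow> real"
  assumes "f differentiable at (u + s *\<^sub>R axis i 1)"
  shows "((\<lambda>s. f (u + s *\<^sub>R axis i 1)) has_real_derivative partial i f (u + s *\<^sub>R axis i 1)) (at s)"
proof -
  have "((\<lambda>s. u + s *\<^sub>R axis i 1) has_derivative (\<lambda>s. s *\<^sub>R axis i (1::real))) (at s)"
    by (auto intro!: derivative_eq_intros)
  from diff_chain_at[OF this assms[unfolded frechet_derivative_works]]
  show ?thesis
    using linear_cmul[OF linear_frechet_derivative[OF assms]]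
    by (simp add: has_field_derivative_def o_def partial_def mult.commute[of _ "frechet_derivative _ _ _"])
qed

text \<open>The mean value theorem in the direction \<open>i\<close> and then in the direction \<open>j\<close>. The left-hand side is
symmetric in \<open>i\<close> and \<open>j\<close>, which gives the symmetry of second derivatives by letting \<open>h\<close> tend to zero.\<close>

lemma second_difference:
  fixes f :: "real^'n::finite \<Rightarrow> real"
  assumes f: "smooth_on U f" and U: "open U" "ball u r \<subseteq> U" and h: "0 < h" "2 * h < r"
  shows "\<exists>w \<in> ball u (2 * h). f (u + h *\<^sub>R axis i 1 + h *\<^sub>R axis j 1) - f (u + h *\<^sub>R axis i 1)
           - f (u + h *\<^sub>R axis j 1) + f u = h\<^sup>2 * partial j (partial i f) w"
proof -
  let ?e = "axis i (1::real)" and ?e' = "axis j (1::real)"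
  have near: "norm (s *\<^sub>R ?e + t *\<^sub>R ?e') \<le> s + t" if "0 \<le> s" "0 \<le> t" for s t
    using norm_triangle_ineq[of "s *\<^sub>R ?e" "t *\<^sub>R ?e'"] that by simp
  have dist_add: "dist u (u + v) = norm v" for v by (simp add: dist_norm)
  have inU: "u + s *\<^sub>R ?e + t *\<^sub>R ?e' \<in> U" if "0 \<le> s" "s \<le> h" "0 \<le> t" "t \<le> h" for s t
  proof -
    have "dist u (u + (s *\<^sub>R ?e + t *\<^sub>R ?e')) < r"
      using near[OF that(1,3)] that h by (simp add: dist_add)
    then show ?thesis using U(2) by (auto simp: add.assoc)
  qed
  define F where "F s = f (u + h *\<^sub>R ?e' + s *\<^sub>R ?e) - f (u + s *\<^sub>R ?e)" for s
  have "(F has_real_derivative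
      partial i f (u + h *\<^sub>R ?e' + s *\<^sub>R ?e) - partial i f (u + s *\<^sub>R ?e)) (at s)"
    if "0 \<le> s" "s \<le> h" for s
    unfolding F_def
    using inU[OF that, of h] inU[OF that, of 0] h(1)
    by (intro DERIV_diff has_real_derivative_along_axis smooth_on_imp_differentiable[OF f U(1)])
      (simp_all add: add_ac)
  from MVT2[OF h(1) this] obtain s where s: "0 < s" "s < h"
    "F h - F 0 = h * (partial i f (u + h *\<^sub>R ?e' + s *\<^sub>R ?e) - partial i f (u + s *\<^sub>R ?e))"
    by auto
  have "((\<lambda>t. partial i f (u + s *\<^sub>R ?e + t *\<^sub>R ?e')) has_real_derivative
      partial j (partial i f) (u + s *\<^sub>R ?e + t *\<^sub>R ?e')) (at t)"
    if "0 \<le> t" "t \<le> h" for t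
    using inU[of s t] that s
    by (intro has_real_derivative_along_axis smooth_on_imp_differentiable[OF smooth_on_partial[OF f] U(1)]) auto
  from MVT2[OF h(1) this] obtain t where t: "0 < t" "t < h"
    "partial i f (u + s *\<^sub>R ?e + h *\<^sub>R ?e') - partial i f (u + s *\<^sub>R ?e) =
       h * partial j (partial i f) (u + s *\<^sub>R ?e + t *\<^sub>R ?e')" by auto
  have "dist u (u + (s *\<^sub>R ?e + t *\<^sub>R ?e')) < 2 * h"
    using near[of s t] s t by (simp add: dist_add)
  moreover have "F h - F 0 = h\<^sup>2 * partial j (partial i f) (u + s *\<^sub>R ?e + t *\<^sub>R ?e')"
    using s(3) t(3) by (simp add: add_ac power2_eq_square)
  ultimately show ?thesis
    by (intro bexI[of _ "u + s *\<^sub>R ?e + t *\<^sub>R ?e'"]) (auto simp: F_def add_ac)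
qed

theorem partial_commute:
  fixes f :: "real^'n::finite \<Rightarrow> real"
  assumes f: "smooth_on U f" and U: "open U" "u \<in> U"
  shows "partial i (partial j f) u = partial j (partial i f) u"
proof (rule ccontr)
  let ?a = "partial i (partial j f)" and ?b = "partial j (partial i f)"
  assume "?a u \<noteq> ?b u"
  then have \<epsilon>: "0 < \<bar>?a u - ?b u\<bar> / 2" by simp
  have "isCont ?a u" "isCont ?b u"
    using U smooth_on_imp_continuous_on[OF smooth_on_partial[OF smooth_on_partial[OF f]]]
    by (auto simp: continuous_on_eq_continuous_at)
  then obtain d1 d2 where d: "0 < d1" "\<And>w. dist w u < d1 \<Longrightarrow> dist (?a w) (?a u) < \<bar>?a u - ?b u\<bar> / 2"
      "0 < d2" "\<And>w. dist w u < d2 \<Longrightarrow> dist (?b w) (?b u) < \<bar>?a u - ?b u\<bar> / 2"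
    unfolding continuous_at_eps_delta using \<epsilon> by metis
  obtain r where r: "0 < r" "ball u r \<subseteq> U" using U openE by blast
  define h where "h = min r (min d1 d2) / 3"
  have h: "0 < h" "2 * h < r" "2 * h < d1" "2 * h < d2" using r d by (auto simp: h_def)
  obtain w where w: "w \<in> ball u (2 * h)" "f (u + h *\<^sub>R axis i 1 + h *\<^sub>R axis j 1) - f (u + h *\<^sub>R axis i 1)
      - f (u + h *\<^sub>R axis j 1) + f u = h\<^sup>2 * ?b w"
    using second_difference[OF f U(1) r(2) h(1,2), of i j] by blast
  obtain w' where w': "w' \<in> ball u (2 * h)" "f (u + h *\<^sub>R axis j 1 + h *\<^sub>R axis i 1) - f (u + h *\<^sub>R axis j 1)
      - f (u + h *\<^sub>R axis i 1) + f u = h\<^sup>2 * ?a w'"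
    using second_difference[OF f U(1) r(2) h(1,2), of j i] by blast
  have "h\<^sup>2 * ?b w = h\<^sup>2 * ?a w'"
    unfolding w(2)[symmetric] w'(2)[symmetric] by (simp add: add_ac)
  then have "?b w = ?a w'" using h(1) by simp
  moreover have "dist (?a w') (?a u) < \<bar>?a u - ?b u\<bar> / 2" "dist (?b w) (?b u) < \<bar>?a u - ?b u\<bar> / 2"
    using d(2)[of w'] d(4)[of w] w(1) w'(1) h by (auto simp: dist_commute[of u])
  ultimately have "dist (?a u) (?b u) < \<bar>?a u - ?b u\<bar>"
    by (metis dist_triangle_half_r)
  then show False by (simp add: dist_real_def)
qed

section \<open>Differentiability of the inverse matrix\<close>

lemma differentiable_prod:
  fixes f :: "'i \<Rightarrow> 'a::real_normed_vector \<Rightarrow> real"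
  assumes "\<And>a. a \<in> I \<Longrightarrow> f a differentiable at u"
  shows "(\<lambda>x. \<Prod>a\<in>I. f a x) differentiable at u"
  using assms by (induction I rule: infinite_finite_induct) auto

lemma differentiable_det:
  fixes M :: "'a::real_normed_vector \<Rightarrow> real^'n^'n"
  assumes "\<And>i j. (\<lambda>x. M x $ i $ j) differentiable at u"
  shows "(\<lambda>x. det (M x)) differentiable at u"
  unfolding det_def
  by (intro differentiable_sum differentiable_mult differentiable_const differentiable_prod assms ballI
      finite_permutations finite)

lemma matrix_inv_right:
  fixes M :: "real^'n^'n"
  assumes "det M \<noteq> 0"
  shows "M ** matrix_inv M = mat 1"
proof -
  have "\<exists>N. M ** N = mat 1 \<and> N ** M = mat 1"
    using assms by (simp add: invertible_det_nz flip: invertible_def)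
  then have "M ** matrix_inv M = mat 1 \<and> matrix_inv M ** M = mat 1"
    unfolding matrix_inv_def by (rule someI_ex)
  then show ?thesis ..
qed

lemma matrix_inv_component:
  fixes M :: "real^'n^'n"
  assumes "det M \<noteq> 0"
  shows "matrix_inv M $ l $ m = det (\<chi> i j. if j = l then axis m 1 $ i else M $ i $ j) / det M"
proof -
  have "M *v (matrix_inv M *v axis m 1) = axis m 1"
    by (simp add: matrix_vector_mul_assoc matrix_inv_right[OF assms])
  then have "matrix_inv M *v axis m 1 =
      (\<chi> l. det (\<chi> i j. if j = l then axis m 1 $ i else M $ i $ j) / det M)"
    using cramer[OF assms] by blast
  moreover have "(matrix_inv M *v axis m 1) $ l = matrix_inv M $ l $ m"
    by (simp add: matrix_vector_mul_component inner_axis)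
  ultimately show ?thesis by simp
qed

lemma differentiable_matrix_inv:
  fixes M :: "'a::real_normed_vector \<Rightarrow> real^'n^'n"
  assumes "\<And>i j. (\<lambda>x. M x $ i $ j) differentiable at u"
    and "open U" "u \<in> U" "\<And>x. x \<in> U \<Longrightarrow> det (M x) \<noteq> 0"
  shows "(\<lambda>x. matrix_inv (M x) $ l $ m) differentiable at u"
proof -
  have "(\<lambda>x. if j = l then axis m 1 $ i else M x $ i $ j) differentiable at u" for i j
    by (cases "j = l") (simp_all add: assms(1))
  then have "(\<lambda>x. det (\<chi> i j. if j = l then axis m 1 $ i else M x $ i $ j) / det (M x)) differentiable at u"
    using assms(1,3,4) by (intro differentiable_divide differentiable_det) simp_all
  then obtain D where "((\<lambda>x. det (\<chi> i j. if j = l then axis m 1 $ i else M x $ i $ j) / det (M x))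
      has_derivative D) (at u)" by (auto simp: differentiable_def)
  then show ?thesis
    by (rule differentiableI[OF has_derivative_transform_within_open[OF _ assms(2,3)]])
      (simp add: matrix_inv_component assms(4))
qed

section \<open>Charts and tangent spaces\<close>

context smooth_manifold
begin

lemma topspace_chart: "c \<in> A \<Longrightarrow> topspace (subtopology X (fst c)) = fst c"
  using openin_subset[OF chart_domain, of c] by (simp add: Int_absorb1)

lemma inj_on_chart: "c \<in> A \<Longrightarrow> inj_on (snd c) (fst c)"
  using homeomorphic_imp_injective_map[OF chart_homeomorphism, of c]
  by (simp only: topspace_chart)

lemma chart_inv_chart: "c \<in> A \<Longrightarrow> p \<in> fst c \<Longrightarrow> chart_inv c (snd c p) = p"
  unfolding chart_inv_def by (simp add: inj_on_chart)

lemma open_chart_image: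
  assumes "c \<in> A" "openin X W"
  shows "open (snd c ` (fst c \<inter> W))"
proof -
  have "openin (subtopology X (fst c)) (fst c \<inter> W)"
    using assms(2) by (rule openin_subtopology_Int2)
  then have "openin (top_of_set (snd c ` fst c)) (snd c ` (fst c \<inter> W))"
    by (subst homeomorphic_map_openness[OF chart_homeomorphism[OF assms(1)]])
      (simp_all only: topspace_chart[OF assms(1)] Int_lower1)
  then show ?thesis
    using chart_image[OF assms(1)] by (rule openin_open_trans)
qed

lemma charts_at_D:
  assumes "c \<in> charts_at A p"
  shows "c \<in> A" "p \<in> fst c"
  using assms by (auto simp: charts_at_def)

lemma transition_chart: "c \<in> charts_at A p \<Longrightarrow> transition c d (snd c p) = snd d p"
  using chart_inv_chart by (simp add: transition_def charts_at_def)

lemma transition_differentiable: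
  assumes "c \<in> charts_at A p" "d \<in> charts_at A p"
  shows "transition c d differentiable at (snd c p)"
proof (rule smooth_on_imp_differentiable)
  note c = charts_at_D[OF assms(1)] and d = charts_at_D[OF assms(2)]
  show "smooth_on (snd c ` (fst c \<inter> fst d)) (transition c d)"
    using c(1) d(1) by (rule charts_compatible)
  show "open (snd c ` (fst c \<inter> fst d))"
    using c(1) chart_domain[OF d(1)] by (rule open_chart_image)
  show "snd c p \<in> snd c ` (fst c \<inter> fst d)"
    using c(2) d(2) by blast
qed

lemma transition_derivative_self:
  assumes "c \<in> charts_at A p"
  shows "frechet_derivative (transition c c) (at (snd c p)) a = a"
proof -
  have "frechet_derivative (transition c c) (at (snd c p)) = frechet_derivative id (at (snd c p))"
    using charts_at_D[OF assms]
    by (intro frechet_derivative_transform_within_open[OF transition_differentiable[OF assms assms] chart_image])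
      (auto simp: transition_def chart_inv_chart)
  then show ?thesis by simp
qed

text \<open>The chain rule for changes of charts. It makes the components of \<open>tangent_of A p c a\<close> compatible with each
other, so that the tangent space is parametrised by the components in a single chart.\<close>

lemma transition_derivative_compose:
  assumes "c \<in> charts_at A p" "d \<in> charts_at A p" "e \<in> charts_at A p"
  shows "frechet_derivative (transition d e) (at (snd d p))
      (frechet_derivative (transition c d) (at (snd c p)) a) =
    frechet_derivative (transition c e) (at (snd c p)) a"
proof -
  note cd = transition_differentiable[OF assms(1,2)]
  have de: "transition d e differentiable at (transition c d (snd c p))"
    using transition_differentiable[OF assms(2,3)] by (simp add: transition_chart[OF assms(1)])
  have "frechet_derivative (transition d e \<circ> transition c d) (at (snd c p)) =
      frechet_derivative (transition c e) (at (snd c p))"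
  proof (rule frechet_derivative_transform_within_open)
    show "transition d e \<circ> transition c d differentiable at (snd c p)"
      by (rule differentiable_chain_at[OF cd de])
    show "open (snd c ` (fst c \<inter> (fst d \<inter> fst e)))"
      by (intro open_chart_image openin_Int chart_domain charts_at_D(1)[OF assms(1)]
          charts_at_D(1)[OF assms(2)] charts_at_D(1)[OF assms(3)])
    show "snd c p \<in> snd c ` (fst c \<inter> (fst d \<inter> fst e))"
      using charts_at_D(2)[OF assms(1)] charts_at_D(2)[OF assms(2)] charts_at_D(2)[OF assms(3)] by blast
    show "(transition d e \<circ> transition c d) u = transition c e u"
      if u: "u \<in> snd c ` (fst c \<inter> (fst d \<inter> fst e))" for u
    proof -
      obtain q where "q \<in> fst c" "q \<in> fst d" "u = snd c q" using u by blast
      then show ?thesis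
        using charts_at_D(1)[OF assms(1)] charts_at_D(1)[OF assms(2)]
        by (simp add: transition_def chart_inv_chart)
    qed
  qed
  then show ?thesis
    using frechet_derivative_compose[OF cd de] transition_chart[OF assms(1)] by (simp add: fun_eq_iff)
qed

lemma tangent_of_in_tangent_space: "c \<in> charts_at A p \<Longrightarrow> tangent_of A p c a \<in> tangent_space A p"
  by (simp add: tangent_space_def tangent_of_def transition_derivative_compose)

lemma tangent_of_component: "c \<in> charts_at A p \<Longrightarrow> tangent_of A p c a c = a"
  by (simp add: tangent_of_def transition_derivative_self)

lemma tangent_of_components:
  assumes "c \<in> charts_at A p" "v \<in> tangent_space A p"
  shows "tangent_of A p c (v c) = v"
proof
  fix d
  show "tangent_of A p c (v c) d = v d"
  proof (cases "d \<in> charts_at A p")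
    case True
    then have "v d = frechet_derivative (transition c d) (at (snd c p)) (v c)"
      using assms unfolding tangent_space_def by blast
    then show ?thesis using True by (simp only: tangent_of_def if_True)
  next
    case False
    then have "v d = 0" using assms(2) unfolding tangent_space_def by blast
    then show ?thesis using False by (simp add: tangent_of_def)
  qed
qed

lemma linear_tangent_of:
  assumes "c \<in> charts_at A p"
  shows "linear (tangent_of A p c)"
proof -
  have "linear (frechet_derivative (transition c d) (at (snd c p)))" if "d \<in> charts_at A p" for d
    using transition_differentiable[OF assms that] by (rule linear_frechet_derivative)
  then show ?thesis
    by (intro linearI) (auto simp: tangent_of_def scaleR_fun_def fun_eq_iff linear_add linear_cmul)
qed

end

section \<open>The metric and its Christoffel symbols in a chart\<close>

lemma linear_functional_components:
  fixes f :: "real^'n::finite \<Rightarrow> real"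
  assumes "linear f"
  shows "f a = (\<Sum>i\<in>UNIV. a $ i * f (axis i 1))"
proof -
  have "f a = f (\<Sum>i\<in>UNIV. a $ i *\<^sub>R axis i 1)"
    using basis_expansion[of a] by (simp add: scalar_mult_eq_scaleR)
  then show ?thesis by (simp add: linear_sum[OF assms] linear_cmul[OF assms])
qed

context riemannian_manifold
begin

lemma metric_gram:
  assumes c: "c \<in> charts_at A p"
  shows "g p (tangent_of A p c a) (tangent_of A p c b) = a \<bullet> (gram A g c (snd c p) *v b)"
proof -
  let ?\<tau> = "tangent_of A p c"
  note T = tangent_of_in_tangent_space[OF c]
  have p: "p \<in> topspace X"
    using charts_at_D[OF c] chart_domain openin_subset by blast
  have 1: "linear (\<lambda>a. g p (?\<tau> a) (?\<tau> b))" for b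
    using T p by (intro linearI) (simp_all add: linear_add[OF linear_tangent_of[OF c]]
        linear_cmul[OF linear_tangent_of[OF c]] metric_add metric_scaleR)
  have sym: "g p (?\<tau> a) (?\<tau> b) = g p (?\<tau> b) (?\<tau> a)" for a b
    using T p by (intro metric_sym)
  have "g p (?\<tau> a) (?\<tau> b) = (\<Sum>i\<in>UNIV. a $ i * (\<Sum>j\<in>UNIV. b $ j * g p (?\<tau> (axis j 1)) (?\<tau> (axis i 1))))"
    by (subst linear_functional_components[OF 1], subst sym, subst linear_functional_components[OF 1]) simp
  also have "\<dots> = a \<bullet> (gram A g c (snd c p) *v b)"
    using charts_at_D[OF c] sym
    by (simp add: inner_vec_def matrix_vector_mult_def gram_def chart_inv_chart mult.commute)
  finally show ?thesis .
qed

lemma gram_symmetric: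
  assumes "c \<in> A" "u \<in> snd c ` fst c"
  shows "gram A g c u $ i $ j = gram A g c u $ j $ i"
proof -
  obtain p where p: "p \<in> fst c" "u = snd c p" using assms(2) by blast
  then have c: "c \<in> charts_at A p" using assms(1) by (simp add: charts_at_def)
  have "p \<in> topspace X"
    using charts_at_D[OF c] chart_domain openin_subset by blast
  then show ?thesis
    using p assms(1) by (simp add: gram_def chart_inv_chart metric_sym tangent_of_in_tangent_space[OF c])
qed

lemma gram_positive:
  assumes c: "c \<in> charts_at A p" and "a \<noteq> 0"
  shows "0 < a \<bullet> (gram A g c (snd c p) *v a)"
proof -
  have "p \<in> topspace X"
    using charts_at_D[OF c] chart_domain openin_subset by blast
  moreover have "tangent_of A p c a \<noteq> 0"
    using tangent_of_component[OF c, of a] \<open>a \<noteq> 0\<close> by auto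
  ultimately show ?thesis
    unfolding metric_gram[OF c, symmetric] by (intro metric_pos tangent_of_in_tangent_space[OF c])
qed

lemma det_gram:
  assumes "c \<in> A" "u \<in> snd c ` fst c"
  shows "det (gram A g c u) \<noteq> 0"
proof -
  obtain p where p: "p \<in> fst c" "u = snd c p" using assms(2) by blast
  then have c: "c \<in> charts_at A p" using assms(1) by (simp add: charts_at_def)
  have "a = 0" if "gram A g c u *v a = 0" for a
    using gram_positive[OF c, of a] that p by fastforce
  then show ?thesis
    unfolding invertible_det_nz[symmetric] invertible_left_inverse matrix_left_invertible_ker by blast
qed

context
  fixes c assumes c: "c \<in> A"
begin

abbreviation "U \<equiv> snd c ` fst c"
abbreviation "G i j \<equiv> \<lambda>u. gram A g c u $ i $ j"
abbreviation "\<Gamma> \<equiv> christoffel A g c"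

lemma open_U: "open U" using c by (rule chart_image)

lemmas smooth_G = metric_smooth[OF c]
lemmas diff_G = smooth_on_imp_differentiable[OF smooth_G open_U]
lemmas diff_dG = smooth_on_imp_differentiable[OF smooth_on_partial[OF smooth_G] open_U]

lemma partial_G_sym: "u \<in> U \<Longrightarrow> partial k (G i j) u = partial k (G j i) u"
  using gram_symmetric[OF c] by (intro partial_cong_on_open[OF diff_G open_U]) auto

lemma partial_partial_G_sym:
  "u \<in> U \<Longrightarrow> partial l (partial k (G i j)) u = partial l (partial k (G j i)) u"
  using partial_G_sym by (intro partial_cong_on_open[OF diff_dG open_U]) auto

lemma differentiable_christoffel:
  assumes "u \<in> U" shows "\<Gamma> l i j differentiable at u"
  unfolding christoffel_def[abs_def]
  using assms det_gram[OF c]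
  by (intro differentiable_divide differentiable_sum differentiable_mult differentiable_matrix_inv[OF _ open_U]
      differentiable_diff differentiable_add diff_dG diff_G finite ballI) auto

text \<open>The Christoffel symbols of the first kind: the index of the ordinary symbols is lowered with the metric.
They contain no inverse matrix, so that their derivatives are explicit.\<close>

definition first_kind :: "'n \<Rightarrow> 'n \<Rightarrow> 'n \<Rightarrow> real^'n \<Rightarrow> real"
  where "first_kind i j m u = (partial i (G j m) u + partial j (G i m) u - partial m (G i j) u) / 2"

lemma first_kind_sym: "u \<in> U \<Longrightarrow> first_kind i j m u = first_kind j i m u"
  by (simp add: first_kind_def partial_G_sym)

lemma christoffel_eq: "\<Gamma> l i j u = (\<Sum>m\<in>UNIV. matrix_inv (gram A g c u) $ l $ m * first_kind i j m u)"
  by (simp add: christoffel_def first_kind_def sum_divide_distrib)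

lemma christoffel_sym: "u \<in> U \<Longrightarrow> \<Gamma> l i j u = \<Gamma> l j i u"
  by (simp add: christoffel_eq first_kind_sym)

lemma lower_christoffel:
  assumes "u \<in> U"
  shows "(\<Sum>l\<in>UNIV. G m l u * \<Gamma> l i j u) = first_kind i j m u"
proof -
  have "(\<Sum>l\<in>UNIV. G m l u * \<Gamma> l i j u) =
      (\<Sum>k\<in>UNIV. (gram A g c u ** matrix_inv (gram A g c u)) $ m $ k * first_kind i j k u)"
    by (simp add: christoffel_eq sum_distrib_left sum_distrib_right matrix_matrix_mult_def mult.assoc)
      (rule sum.swap)
  also have "\<dots> = first_kind i j m u"
    by (simp add: matrix_inv_right[OF det_gram[OF c assms]] mat_def if_distrib[of "\<lambda>x. x * _"] cong: if_cong)
  finally show ?thesis .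
qed

lemma metric_compatible: "u \<in> U \<Longrightarrow> partial k (G i j) u = first_kind k i j u + first_kind k j i u"
  by (simp add: first_kind_def partial_G_sym[of u k j i] partial_G_sym[of u j i k] partial_G_sym[of u i j k] field_simps)

text \<open>The part of the lowered curvature tensor that is quadratic in the Christoffel symbols.\<close>

definition christoffel_product :: "'n \<Rightarrow> 'n \<Rightarrow> 'n \<Rightarrow> 'n \<Rightarrow> real^'n \<Rightarrow> real"
  where "christoffel_product i m j k u = (\<Sum>l\<in>UNIV. first_kind i m l u * \<Gamma> l j k u)"

lemma christoffel_product_sym:
  assumes "u \<in> U"
  shows "christoffel_product i m j k u = christoffel_product j k i m u"
proof -
  have eq: "christoffel_product i m j k u = (\<Sum>l\<in>UNIV. \<Sum>n\<in>UNIV. G l n u * \<Gamma> n i m u * \<Gamma> l j k u)" for i m j k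
    by (simp add: christoffel_product_def sum_distrib_right flip: lower_christoffel[OF assms])
  have "christoffel_product i m j k u = (\<Sum>n\<in>UNIV. \<Sum>l\<in>UNIV. G l n u * \<Gamma> n i m u * \<Gamma> l j k u)"
    unfolding eq by (rule sum.swap)
  also have "\<dots> = christoffel_product j k i m u"
    unfolding eq using gram_symmetric[OF c assms] by (simp add: mult_ac)
  finally show ?thesis .
qed

lemma christoffel_product_sym_1: "u \<in> U \<Longrightarrow> christoffel_product i m j k u = christoffel_product m i j k u"
  by (simp add: christoffel_product_def first_kind_sym[of u i m])

lemma christoffel_product_sym_2: "u \<in> U \<Longrightarrow> christoffel_product i m j k u = christoffel_product i m k j u"
  by (simp add: christoffel_product_def christoffel_sym[of u _ j k])

text \<open>Differentiating \<open>lower_christoffel\<close> with the product rule isolates the derivative of the Christoffel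
symbols, and thus avoids differentiating the inverse matrix explicitly; only its differentiability is
used.\<close>

lemma lower_partial_christoffel:
  assumes u: "u \<in> U"
  shows "(\<Sum>l\<in>UNIV. G m l u * partial i (\<Gamma> l j k) u) =
     (partial i (partial j (G k m)) u + partial i (partial k (G j m)) u - partial i (partial m (G j k)) u) / 2
     - christoffel_product i m j k u - (\<Sum>l\<in>UNIV. first_kind i l m u * \<Gamma> l j k u)"
proof -
  have diff: "(\<lambda>u. G m l u * \<Gamma> l j k u) differentiable at u" for l
    using diff_G[OF u] differentiable_christoffel[OF u] by (rule differentiable_mult)
  have "partial i (\<lambda>u. \<Sum>l\<in>UNIV. G m l u * \<Gamma> l j k u) u = partial i (first_kind j k m) u"
  proof (rule partial_cong_on_open[OF _ open_U u])
    show "(\<lambda>u. \<Sum>l\<in>UNIV. G m l u * \<Gamma> l j k u) differentiable at u"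
      using diff by (intro differentiable_sum) simp_all
  qed (rule lower_christoffel)
  moreover have "partial i (\<lambda>u. \<Sum>l\<in>UNIV. G m l u * \<Gamma> l j k u) u =
      (\<Sum>l\<in>UNIV. partial i (G m l) u * \<Gamma> l j k u) + (\<Sum>l\<in>UNIV. G m l u * partial i (\<Gamma> l j k) u)"
    by (simp add: partial_sum diff partial_mult diff_G[OF u] differentiable_christoffel[OF u] sum.distrib)
  moreover have "(\<Sum>l\<in>UNIV. partial i (G m l) u * \<Gamma> l j k u) =
      christoffel_product i m j k u + (\<Sum>l\<in>UNIV. first_kind i l m u * \<Gamma> l j k u)"
    by (simp add: metric_compatible[OF u] christoffel_product_def distrib_right sum.distrib)
  moreover have "partial i (first_kind j k m) u =
     (partial i (partial j (G k m)) u + partial i (partial k (G j m)) u - partial i (partial m (G j k)) u) / 2"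
    unfolding first_kind_def[abs_def]
    using u by (simp add: partial_divide_const partial_add partial_diff differentiable_add differentiable_diff diff_dG)
  ultimately show ?thesis by linarith
qed

section \<open>Pair symmetry of the curvature tensor\<close>

definition lowered_curvature :: "'n \<Rightarrow> 'n \<Rightarrow> 'n \<Rightarrow> 'n \<Rightarrow> real^'n \<Rightarrow> real"
  where "lowered_curvature i j k m u = (\<Sum>l\<in>UNIV. G m l u * riemann_coeff A g c l i j k u)"

text \<open>The classical formula for the curvature tensor with all indices lowered, in second derivatives of the
metric and products of Christoffel symbols. Pair symmetry is visible in it.\<close>

lemma lowered_curvature_eq:
  assumes u: "u \<in> U"
  shows "lowered_curvature i j k m u =
    (partial i (partial k (G j m)) u - partial i (partial m (G j k)) u
     - partial j (partial k (G i m)) u + partial j (partial m (G i k)) u) / 2 - christoffel_product i m j k u + christoffel_product j m i k u"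
proof -
  have quad: "(\<Sum>l\<in>UNIV. G m l u * (\<Sum>n\<in>UNIV. \<Gamma> l i n u * \<Gamma> n j k u)) =
      (\<Sum>n\<in>UNIV. first_kind i n m u * \<Gamma> n j k u)" for i j k
  proof -
    have "(\<Sum>l\<in>UNIV. G m l u * (\<Sum>n\<in>UNIV. \<Gamma> l i n u * \<Gamma> n j k u)) =
        (\<Sum>n\<in>UNIV. \<Sum>l\<in>UNIV. G m l u * \<Gamma> l i n u * \<Gamma> n j k u)"
      by (subst sum.swap) (simp add: sum_distrib_left mult.assoc)
    then show ?thesis by (simp add: lower_christoffel[OF u] flip: sum_distrib_right)
  qed
  have "lowered_curvature i j k m u =
      (\<Sum>l\<in>UNIV. G m l u * partial i (\<Gamma> l j k) u) - (\<Sum>l\<in>UNIV. G m l u * partial j (\<Gamma> l i k) u)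
      + (\<Sum>l\<in>UNIV. G m l u * (\<Sum>n\<in>UNIV. \<Gamma> l i n u * \<Gamma> n j k u))
      - (\<Sum>l\<in>UNIV. G m l u * (\<Sum>n\<in>UNIV. \<Gamma> l j n u * \<Gamma> n i k u))"
    by (simp add: lowered_curvature_def riemann_coeff_def sum_subtractf sum.distrib algebra_simps)
  moreover have "partial i (partial j (G k m)) u = partial j (partial i (G k m)) u"
    by (rule partial_commute[OF smooth_G open_U u])
  ultimately show ?thesis
    unfolding quad lower_partial_christoffel[OF u] by (simp add: field_simps)
qed

lemma lowered_curvature_pair:
  assumes u: "u \<in> U"
  shows "lowered_curvature i j k m u = lowered_curvature k m i j u"
proof -
  have H: "partial a (partial b (G d e)) u = partial b (partial a (G e d)) u" for a b d e
    by (metis partial_commute[OF smooth_G open_U u] partial_partial_G_sym[OF u])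
  have "christoffel_product k j m i u = christoffel_product i m j k u" "christoffel_product m j k i u = christoffel_product j m i k u"
    by (metis christoffel_product_sym[OF u] christoffel_product_sym_1[OF u] christoffel_product_sym_2[OF u])+
  then show ?thesis
    unfolding lowered_curvature_eq[OF u]
    using H[of k i m j] H[of k j m i] H[of m i k j] H[of m j k i] by simp
qed

end

end

lemma sum_swap_pairs:
  "(\<Sum>i\<in>I. \<Sum>j\<in>J. \<Sum>k\<in>K. \<Sum>m\<in>M. f i j k m) = (\<Sum>k\<in>K. \<Sum>m\<in>M. \<Sum>i\<in>I. \<Sum>j\<in>J. f i j k m)"
  for f :: "_ \<Rightarrow> _ \<Rightarrow> _ \<Rightarrow> _ \<Rightarrow> real"
proof -
  have "(\<Sum>i\<in>I. \<Sum>j\<in>J. \<Sum>k\<in>K. \<Sum>m\<in>M. f i j k m) = (\<Sum>i\<in>I. \<Sum>k\<in>K. \<Sum>j\<in>J. \<Sum>m\<in>M. f i j k m)"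
    by (intro sum.cong refl sum.swap)
  also have "\<dots> = (\<Sum>k\<in>K. \<Sum>i\<in>I. \<Sum>m\<in>M. \<Sum>j\<in>J. f i j k m)"
    by (subst sum.swap) (intro sum.cong refl sum.swap)
  also have "\<dots> = (\<Sum>k\<in>K. \<Sum>m\<in>M. \<Sum>i\<in>I. \<Sum>j\<in>J. f i j k m)"
    by (intro sum.cong refl sum.swap)
  finally show ?thesis .
qed

section \<open>Curvature and Jacobi operators in one tangent space\<close>

definition curvature_in_chart ::
    "('m, 'n::finite) chart set \<Rightarrow> ('m, 'n) metric \<Rightarrow> ('m, 'n) chart \<Rightarrow> real^'n \<Rightarrow>
     real^'n \<Rightarrow> real^'n \<Rightarrow> real^'n \<Rightarrow> real^'n"
  where "curvature_in_chart A g c u x y z = (\<Sum>i\<in>UNIV. \<Sum>j\<in>UNIV. \<Sum>k\<in>UNIV.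
    (x $ i * y $ j * z $ k) *\<^sub>R (\<chi> l. riemann_coeff A g c l i j k u))"

lemma linear_curvature_in_chart:
  "linear (\<lambda>x. curvature_in_chart A g c u x y z)"
  "linear (\<lambda>y. curvature_in_chart A g c u x y z)"
  "linear (\<lambda>z. curvature_in_chart A g c u x y z)"
  by (intro linearI; simp add: curvature_in_chart_def algebra_simps sum.distrib scaleR_sum_right)+

lemma curvature_in_chart_skew:
  "curvature_in_chart A g c u x y z = - curvature_in_chart A g c u y x z"
proof -
  have skew: "(\<chi> l. riemann_coeff A g c l i j k u) = - (\<chi> l. riemann_coeff A g c l j i k u)" for i j k
    by (simp add: vec_eq_iff riemann_coeff_def sum_subtractf)
  show ?thesis
    unfolding curvature_in_chart_def
    by (subst sum.swap, subst skew) (simp add: sum_negf mult_ac)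
qed

context riemannian_manifold
begin

lemma curvature_in_chart_pair_symmetric:
  assumes c: "c \<in> A" "u \<in> snd c ` fst c"
  shows "w \<bullet> (gram A g c u *v curvature_in_chart A g c u x y z) =
         y \<bullet> (gram A g c u *v curvature_in_chart A g c u z w x)"
proof -
  have eq: "w \<bullet> (gram A g c u *v curvature_in_chart A g c u x y z) =
      (\<Sum>i\<in>UNIV. \<Sum>j\<in>UNIV. \<Sum>k\<in>UNIV. \<Sum>m\<in>UNIV.
        x $ i * y $ j * z $ k * w $ m * lowered_curvature c i j k m u)" for w x y z
  proof -
    have "w \<bullet> (gram A g c u *v (\<chi> l. riemann_coeff A g c l i j k u)) =
        (\<Sum>m\<in>UNIV. w $ m * lowered_curvature c i j k m u)" for i j k
      by (simp add: lowered_curvature_def[OF c(1)] inner_vec_def matrix_vector_mult_def)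
    then show ?thesis
      by (simp add: curvature_in_chart_def linear_sum[OF matrix_vector_mul_linear]
          linear_cmul[OF matrix_vector_mul_linear] inner_sum_right sum_distrib_left mult.assoc)
  qed
  show ?thesis
    unfolding eq
    by (subst sum_swap_pairs) (simp add: lowered_curvature_pair[OF c] mult_ac)
qed

text \<open>A chart identifies the tangent space with a coordinate space that carries the inner product given by the
Gram matrix; composing with the square root of its inverse turns this into the standard inner product, so
that the results on algebraic curvature tensors apply.\<close>

lemma curvature_pointwise_normal_form:
  assumes p: "p \<in> topspace X"
  obtains R :: "real^'n \<Rightarrow> real^'n \<Rightarrow> real^'n \<Rightarrow> real^'n" and \<phi> :: "real^'n \<Rightarrow> ('m, 'n) tangent"
  where "curvature_tensor R" "linear \<phi>" "inj \<phi>" "range \<phi> = tangent_space A p"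
    "\<And>x y. g p (\<phi> x) (\<phi> y) = x \<bullet> y"
    "\<And>x y z. curvature A g p (\<phi> x) (\<phi> y) (\<phi> z) = \<phi> (R x y z)"
proof -
  define c where "c = (SOME c. c \<in> charts_at A p)"
  have "\<exists>c. c \<in> charts_at A p"
    using p charts_cover unfolding charts_at_def by blast
  then have c: "c \<in> charts_at A p" unfolding c_def by (rule someI_ex)
  define u where "u = snd c p"
  let ?G = "gram A g c u" and ?R = "curvature_in_chart A g c u"
  have cA: "c \<in> A" "u \<in> snd c ` fst c" using charts_at_D[OF c] by (auto simp: u_def)
  have G_self_adjoint: "(?G *v x) \<bullet> y = x \<bullet> (?G *v y)" for x y
  proof -
    have "transpose ?G = ?G"
      using gram_symmetric[OF cA] by (simp add: transpose_def vec_eq_iff)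
    then show ?thesis by (metis dot_lmul_matrix transpose_matrix_vector)
  qed
  obtain h :: "real^'n \<Rightarrow> real^'n" where h: "linear h" "\<And>x y. h x \<bullet> (?G *v h y) = x \<bullet> y"
    by (rule inner_product_normal_form[OF matrix_vector_mul_linear G_self_adjoint])
      (auto intro: gram_positive[OF c, folded u_def])
  have "inj h"
  proof (rule linear_injective_0[OF h(1), THEN iffD2], intro allI impI)
    fix x assume "h x = 0"
    then have "x \<bullet> x = 0" using h(2)[of x x] by simp
    then show "x = 0" by simp
  qed
  then have "surj h" by (rule linear_inj_imp_surj[OF h(1)])
  have inv: "linear (inv h)" "\<And>x. h (inv h x) = x"
    using \<open>inj h\<close> \<open>surj h\<close> h(1) by (auto simp: surj_f_inv_f intro: inj_linear_imp_inv_linear)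
  define R where "R x y z = inv h (?R (h x) (h y) (h z))" for x y z
  define \<phi> where "\<phi> x = tangent_of A p c (h x)" for x
  have R: "h (R x y z) = ?R (h x) (h y) (h z)" for x y z
    by (simp add: R_def inv(2))
  have "curvature_tensor R"
  proof (rule curvature_tensor.intro)
    show "linear (\<lambda>x. R x y z)" for y z
      unfolding R_def
      by (rule linear_compose[OF linear_compose[OF h(1) linear_curvature_in_chart(1)] inv(1), unfolded o_def])
    show "linear (\<lambda>y. R x y z)" for x z
      unfolding R_def
      by (rule linear_compose[OF linear_compose[OF h(1) linear_curvature_in_chart(2)] inv(1), unfolded o_def])
    show "linear (\<lambda>z. R x y z)" for x y
      unfolding R_def
      by (rule linear_compose[OF linear_compose[OF h(1) linear_curvature_in_chart(3)] inv(1), unfolded o_def])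
    show "R x y z = - R y x z" for x y z
      unfolding R_def by (subst curvature_in_chart_skew) (simp add: linear_neg[OF inv(1)])
    show "R x y z \<bullet> w = R z w x \<bullet> y" for x y z w
      using curvature_in_chart_pair_symmetric[OF cA, of "h w" "h x" "h y" "h z"]
      by (simp add: R[symmetric] h(2) inner_commute)
  qed
  moreover have "linear \<phi>"
    using linear_compose[OF h(1) linear_tangent_of[OF c]] by (simp add: \<phi>_def[abs_def] o_def)
  moreover have "inj \<phi>"
    using \<open>inj h\<close> tangent_of_component[OF c] unfolding \<phi>_def inj_def by metis
  moreover have "range \<phi> = tangent_space A p"
  proof
    show "range \<phi> \<subseteq> tangent_space A p"
      using tangent_of_in_tangent_space[OF c] by (auto simp: \<phi>_def)
    show "tangent_space A p \<subseteq> range \<phi>"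
    proof
      fix v assume "v \<in> tangent_space A p"
      then have "v = \<phi> (inv h (v c))" by (simp add: \<phi>_def inv(2) tangent_of_components[OF c])
      then show "v \<in> range \<phi>" by blast
    qed
  qed
  moreover have "g p (\<phi> x) (\<phi> y) = x \<bullet> y" for x y
    by (simp add: \<phi>_def metric_gram[OF c] h(2) flip: u_def)
  moreover have "curvature A g p (\<phi> x) (\<phi> y) (\<phi> z) = \<phi> (R x y z)" for x y z
  proof -
    have "?R a b d = (\<chi> l. \<Sum>i\<in>UNIV. \<Sum>j\<in>UNIV. \<Sum>k\<in>UNIV.
        riemann_coeff A g c l i j k u * a $ i * b $ j * d $ k)" for a b d
      by (simp add: vec_eq_iff curvature_in_chart_def mult_ac)
    then show ?thesis
      by (simp add: curvature_def Let_def \<phi>_def R tangent_of_component[OF c] flip: c_def u_def)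
  qed
  ultimately show ?thesis using that by blast
qed

(* All coordinate computations enter the final argument through this normal form. *)
thm_deps curvature_pointwise_normal_form

lemma pointwise_equivalence:
  assumes p: "p \<in> topspace X"
  shows "(\<forall>x \<in> unit_tangent_vectors A g p. \<forall>x' \<in> unit_tangent_vectors A g p.
      \<forall>\<mu>. jacobi_multiplicity A g p x \<mu> = jacobi_multiplicity A g p x' \<mu>) \<longleftrightarrow>
    (\<forall>x \<in> unit_tangent_vectors A g p. \<forall>y \<in> unit_tangent_vectors A g p.
      \<forall>\<mu>. jacobi A g p x y = \<mu> *\<^sub>R y \<longrightarrow> jacobi A g p y x = \<mu> *\<^sub>R x)"
proof -
  obtain R :: "real^'n \<Rightarrow> real^'n \<Rightarrow> real^'n \<Rightarrow> real^'n" and \<phi> :: "real^'n \<Rightarrow> ('m, 'n) tangent"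
    where R: "curvature_tensor R" and \<phi>: "linear \<phi>" "inj \<phi>" "range \<phi> = tangent_space A p"
      "\<And>x y. g p (\<phi> x) (\<phi> y) = x \<bullet> y"
      "\<And>x y z. curvature A g p (\<phi> x) (\<phi> y) (\<phi> z) = \<phi> (R x y z)"
    using curvature_pointwise_normal_form[OF p] by blast
  have unit: "unit_tangent_vectors A g p = \<phi> ` {x. norm x = 1}"
    by (auto simp: unit_tangent_vectors_def \<phi>(4) norm_eq_1 simp flip: \<phi>(3))
  have jacobi: "jacobi A g p (\<phi> x) (\<phi> y) = \<phi> (jac R x y)" for x y
    by (simp add: jacobi_def jac_def \<phi>(5))
  have eigen: "jacobi A g p (\<phi> x) (\<phi> y) = \<mu> *\<^sub>R \<phi> y \<longleftrightarrow> jac R x y = \<mu> *\<^sub>R y" for x y \<mu>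
    using \<open>inj \<phi>\<close> by (simp add: jacobi inj_eq flip: linear_cmul[OF \<phi>(1)])
  have "jacobi_multiplicity A g p (\<phi> x) \<mu> = dim {y. jac R x y = \<mu> *\<^sub>R y}" for x \<mu>
  proof -
    have "{v \<in> tangent_space A p. jacobi A g p (\<phi> x) v = \<mu> *\<^sub>R v} = \<phi> ` {y. jac R x y = \<mu> *\<^sub>R y}"
      by (auto simp: eigen simp flip: \<phi>(3))
    then show ?thesis
      using dim_image_eq[OF \<phi>(1)] \<open>inj \<phi>\<close> by (simp add: jacobi_multiplicity_def inj_on_subset)
  qed
  then have "(\<forall>x \<in> unit_tangent_vectors A g p. \<forall>x' \<in> unit_tangent_vectors A g p.
      \<forall>\<mu>. jacobi_multiplicity A g p x \<mu> = jacobi_multiplicity A g p x' \<mu>) \<longleftrightarrow> osserman R"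
    by (auto simp: unit osserman_def)
  also have "osserman R \<longleftrightarrow> duality R"
    using R by (rule curvature_tensor.osserman_iff_duality)
  also have "duality R \<longleftrightarrow> (\<forall>x \<in> unit_tangent_vectors A g p. \<forall>y \<in> unit_tangent_vectors A g p.
      \<forall>\<mu>. jacobi A g p x y = \<mu> *\<^sub>R y \<longrightarrow> jacobi A g p y x = \<mu> *\<^sub>R x)"
    by (auto simp: unit eigen duality_def)
  finally show ?thesis .
qed

end

theorem theorem1:
  fixes X :: "'m topology" and A :: "('m, 4) chart set" and g :: "('m, 4) metric"
  assumes "riemannian_manifold X A g"
  shows "pointwise_osserman X A g \<longleftrightarrow> rakic_duality X A g"
  unfolding pointwise_osserman_def rakic_duality_def
  by (rule ball_cong[OF refl riemannian_manifold.pointwise_equivalence[OF assms]])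

end
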